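(* Let $\alpha>2$ and $\lambda,r_{\mathrm{gz}},r_{\mathrm{tr}},\rho,\beta>0$. The throughput $\mathrm{T}_{\mathrm{CA}}$ of the coordinated access (CA) MAC protocol employing single antennas satisfies $$\mathrm{T}_{\mathrm{CA}}\le e^{-\frac{\beta r_{\mathrm{tr}}^{\alpha}}{\rho}}\lambda_{\mathrm{CA}}\exp\left\{-\pi\lambda_{\mathrm{CA}}\left(\frac{2(\beta r_{\mathrm{tr}}^{\alpha})^{2/\alpha}\,\Gamma\left(\frac{2}{\alpha}\right)\Gamma\left(1-\frac{2}{\alpha}\right)}{\alpha}-\left(\frac{2r_{\mathrm{gz}}}{\sqrt{\pi}}\right)^{2}{}_2F_1\left(\frac{2}{\alpha},1;1+\frac{2}{\alpha};-\left(\frac{2r_{\mathrm{gz}}}{\sqrt{\pi}\,r_{\mathrm{tr}}}\right)^{\alpha}\frac{1}{\beta}\right)\right)\right\},$$ where $\lambda_{\mathrm{CA}}=\dfrac{1-e^{-4\lambda r_{\mathrm{gz}}^{2}}}{4r_{\mathrm{gz}}^{2}}$.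
   Context: CA protocol model: the plane $\mathbb{R}^2$ is tiled by non-overlapping axis-parallel squares of side length $2r_{\mathrm{gz}}$ arranged in a lattice, with a receiver at the center of each square, one of these (the typical receiver) being at the origin. Potential transmitters form a homogeneous Poisson point process on $\mathbb{R}^2$ of intensity $\lambda$. In each square the transmitters share time by TDMA with as many slots as there are transmitters in that square, so that in a given time slot each nonempty square contains exactly one active transmitter (chosen uniformly at random among the transmitters in the square, independently over squares), and each empty square none. Thus $\lambda_{\mathrm{CA}}$ is the intensity of active transmitters. The typical receiver communicates with its own transmitter at distance $r_{\mathrm{tr}}$; the interferers are the active transmitters in all other squares (i.e. outside the square guard zone of side $2r_{\mathrm{gz}}$ centered at the origin). All channels are single-antenna Rayleigh fading: the power gains $|h_0|^2$ (desired link) and $|h_\ell|^2$ (interferers at locations $X_\ell$) are i.i.d. exponential with mean $1$, independent of the locations. With transmit SNR $\rho$, $$\mathrm{SINR}=\frac{\rho\, r_{\mathrm{tr}}^{-\alpha}|h_0|^2}{\rho\sum_{\ell}|X_\ell|^{-\alpha}|h_\ell|^2+1},$$ $\mathrm{F}(\beta)=\Pr(\mathrm{SINR}\le\beta)$, and the throughput is $\mathrm{T}_{\mathrm{CA}}=\lambda_{\mathrm{CA}}(1-\mathrm{F}(\beta))$. ${}_2F_1$ is the Gauss hypergeometric function (analytically continued to the negative real axis). *)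

theory Defs
  imports "HOL-Probability.Probability" "HOL-Complex_Analysis.Complex_Analysis"
begin

section \<open>The Gauss hypergeometric function\<close>

text \<open>
  The principal branch: the value at \<open>z\<close> of the analytic continuation of the hypergeometric
  series from the open unit disc to the plane cut along \<open>[1, \<infinity>)\<close>.
\<close>

definition hyp2F1_domain :: "complex set" where
  "hyp2F1_domain = - {z. Im z = 0 \<and> 1 \<le> Re z}"

definition hyp2F1 :: "complex \<Rightarrow> complex \<Rightarrow> complex \<Rightarrow> complex \<Rightarrow> complex" where
  "hyp2F1 a b c z = (THE w. \<exists>f. f holomorphic_on hyp2F1_domain \<and>
     (\<forall>u\<in>ball 0 1. f u = eval_fps (fps_hypergeo [a, b] [c] 1) u) \<and> f z = w)"

lemma hyp2F1_eqI:
  assumes "f holomorphic_on hyp2F1_domain"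
    and "\<And>u. u \<in> ball 0 1 \<Longrightarrow> f u = eval_fps (fps_hypergeo [a, b] [c] 1) u"
    and z: "z \<in> hyp2F1_domain"
  shows "hyp2F1 a b c z = f z"
proof -
  have star: "starlike hyp2F1_domain"
    unfolding starlike_def
  proof (intro bexI[of _ 0] ballI subsetI)
    show "0 \<in> hyp2F1_domain" by (simp add: hyp2F1_domain_def)
    fix x y assume x: "x \<in> hyp2F1_domain" and "y \<in> closed_segment 0 x"
    then obtain t where t: "0 \<le> t" "t \<le> 1" "y = t *\<^sub>R x"
      by (auto simp: in_segment)
    show "y \<in> hyp2F1_domain"
    proof (rule ccontr)
      assume "y \<notin> hyp2F1_domain"
      then have y: "t * Im x = 0" "1 \<le> t * Re x" using t by (auto simp: hyp2F1_domain_def)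
      then have "t \<noteq> 0" by auto
      then have "Im x = 0" using y by simp
      moreover have "1 \<le> Re x"
        using y(2) t by (smt (verit) mult_left_le_one_le mult_nonneg_nonpos)
      ultimately show False using x by (simp add: hyp2F1_domain_def)
    qed
  qed
  have "closed {z. Im z = 0 \<and> 1 \<le> Re z}"
    by (intro closed_Collect_conj closed_Collect_eq closed_Collect_le continuous_intros)
  then have op: "open hyp2F1_domain" by (simp add: hyp2F1_domain_def open_Compl)
  have sub: "ball 0 1 \<subseteq> hyp2F1_domain"
  proof
    fix u :: complex assume "u \<in> ball 0 1"
    then have "Re u < 1" using complex_Re_le_cmod[of u] by simp
    then show "u \<in> hyp2F1_domain" by (simp add: hyp2F1_domain_def)
  qed
  have uniq: "g z = f z" if g: "g holomorphic_on hyp2F1_domain"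
    "\<forall>u\<in>ball 0 1. g u = eval_fps (fps_hypergeo [a, b] [c] 1) u" for g
  proof (rule analytic_continuation_open[OF _ op _ starlike_imp_connected[OF star] sub g(1) assms(1) _ z])
    show "open (ball 0 1 :: complex set)" by simp
    show "ball 0 1 \<noteq> ({} :: complex set)" by simp
    show "\<And>u. u \<in> ball 0 1 \<Longrightarrow> g u = f u" using g(2) assms(2) by simp
  qed
  show ?thesis unfolding hyp2F1_def
    by (rule the_equality) (use assms(1,2) uniq in blast)+
qed

text \<open>Real parameters and real argument below 1, where the principal branch is real-valued.\<close>

definition hyp2F1_real :: "real \<Rightarrow> real \<Rightarrow> real \<Rightarrow> real \<Rightarrow> real" where
  "hyp2F1_real a b c x = Re (hyp2F1 (of_real a) (of_real b) (of_real c) (of_real x))"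

section \<open>Point processes in the plane\<close>

type_synonym plane = "real \<times> real"

definition configurations :: "plane set set" where
  "configurations = {S. \<forall>B. bounded B \<longrightarrow> finite (S \<inter> B)}"

definition config_space :: "plane set measure" where
  "config_space = sigma configurations
     {{S \<in> configurations. card (S \<inter> B) = n} | B n. B \<in> sets borel \<and> bounded B}"

text \<open>
  The Poisson probabilities are written out because \<open>poisson_pmf\<close> requires a positive rate,
  whereas \<open>B\<close> may be a null set.
\<close>

definition poisson_process :: "'w measure \<Rightarrow> real \<Rightarrow> ('w \<Rightarrow> plane set) \<Rightarrow> bool" where
  "poisson_process M lam \<Phi> \<longleftrightarrow>
     \<Phi> \<in> M \<rightarrow>\<^sub>M config_space \<and>
     (\<forall>B\<in>sets borel. bounded B \<longrightarrow> (\<forall>n.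
        measure M {\<omega> \<in> space M. card (\<Phi> \<omega> \<inter> B) = n} =
          (lam * measure lborel B) ^ n / fact n * exp (- (lam * measure lborel B)))) \<and>
     (\<forall>B :: nat \<Rightarrow> plane set. disjoint_family B \<and> (\<forall>i. B i \<in> sets borel \<and> bounded (B i)) \<longrightarrow>
        prob_space.indep_vars M (\<lambda>_. count_space UNIV) (\<lambda>i \<omega>. card (\<Phi> \<omega> \<inter> B i)) UNIV)"

text \<open>The mean number of points per unit area, for a process whose mean measure is a multiple of area.\<close>

definition has_intensity :: "'w measure \<Rightarrow> ('w \<Rightarrow> plane set) \<Rightarrow> real \<Rightarrow> bool" where
  "has_intensity M \<Psi> l \<longleftrightarrow> 0 \<le> l \<and>
     (\<forall>B\<in>sets borel. bounded B \<longrightarrow>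
        (\<integral>\<^sup>+\<omega>. ennreal (real (card (\<Psi> \<omega> \<inter> B))) \<partial>M) = ennreal (l * measure lborel B))"

definition intensity :: "'w measure \<Rightarrow> ('w \<Rightarrow> plane set) \<Rightarrow> real" where
  "intensity M \<Psi> = (THE l. has_intensity M \<Psi> l)"

lemma intensity_eqI:
  assumes "has_intensity M \<Psi> l"
  shows "intensity M \<Psi> = l"
  unfolding intensity_def
proof (rule the_equality)
  show "has_intensity M \<Psi> l" by fact
  fix l' assume l': "has_intensity M \<Psi> l'"
  let ?B = "cbox (0, 0) (1, 1) :: plane set"
  have "measure lborel ?B = 1"
    by (simp only: content_Pair) simp
  moreover have "?B \<in> sets borel" "bounded ?B" by (auto intro: borel_closed)
  ultimately have "ennreal l' = ennreal l"
    using l' assms unfolding has_intensity_def by (metis mult.right_neutral)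
  then show "l' = l" using l' assms by (simp add: has_intensity_def)
qed

section \<open>The coordinated access model\<close>

text \<open>
  The squares have side length \<open>2 r\<close> and centers \<open>(2 r i, 2 r j)\<close>; they are taken half-open so
  that they partition the plane. The typical receiver is the center of square \<open>(0, 0)\<close>.
\<close>

definition square :: "real \<Rightarrow> int \<times> int \<Rightarrow> plane set" where
  "square r k = {2 * r * of_int (fst k) - r ..< 2 * r * of_int (fst k) + r} \<times>
                {2 * r * of_int (snd k) - r ..< 2 * r * of_int (snd k) + r}"

definition square_of :: "real \<Rightarrow> plane \<Rightarrow> int \<times> int" where
  "square_of r x = (\<lfloor>(fst x + r) / (2 * r)\<rfloor>, \<lfloor>(snd x + r) / (2 * r)\<rfloor>)"

lemma in_square_iff:
  assumes "r > 0"
  shows "x \<in> square r k \<longleftrightarrow> square_of r x = k"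
proof -
  have *: "\<lfloor>(y + r) / (2 * r)\<rfloor> = i \<longleftrightarrow> y \<in> {2 * r * of_int i - r ..< 2 * r * of_int i + r}" for y i
    using assms by (simp add: floor_eq_iff field_simps)
  show ?thesis by (cases x; cases k) (simp only: square_def square_of_def mem_Times_iff fst_conv snd_conv * prod.inject)
qed

text \<open>
  \<open>\<Psi>\<close> is the set of transmitters active in a time slot. Given \<open>\<Phi>\<close>, the active transmitters of
  different squares are independent and each is uniform among the points of \<open>\<Phi>\<close> in its square:
  conditionally on \<open>\<Phi>\<close>, the active transmitters of the squares \<open>k \<in> K\<close> all exist and lie in
  Borel sets \<open>B k\<close> with probability \<open>\<Prod>k\<in>K. #(\<Phi> \<inter> B k) / #(\<Phi> \<inter> square r k)\<close>
  (a factor being 0 for an empty square, by \<open>0 / 0 = 0\<close>).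
\<close>

definition uniform_selection ::
    "'w measure \<Rightarrow> real \<Rightarrow> ('w \<Rightarrow> plane set) \<Rightarrow> ('w \<Rightarrow> plane set) \<Rightarrow> bool" where
  "uniform_selection M r \<Phi> \<Psi> \<longleftrightarrow>
     \<Psi> \<in> M \<rightarrow>\<^sub>M config_space \<and>
     (\<forall>\<omega>\<in>space M. \<Psi> \<omega> \<subseteq> \<Phi> \<omega> \<and>
        (\<forall>k. card (\<Psi> \<omega> \<inter> square r k) = (if \<Phi> \<omega> \<inter> square r k = {} then 0 else 1))) \<and>
     (\<forall>A\<in>sets config_space. \<forall>K B. finite K \<and> (\<forall>k\<in>K. B k \<in> sets borel \<and> B k \<subseteq> square r k) \<longrightarrow>
        measure M {\<omega> \<in> space M. \<Phi> \<omega> \<in> A \<and> (\<forall>k\<in>K. \<Psi> \<omega> \<inter> B k \<noteq> {})} =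
        (\<integral>\<omega>. indicator A (\<Phi> \<omega>) *
             (\<Prod>k\<in>K. real (card (\<Phi> \<omega> \<inter> B k)) / real (card (\<Phi> \<omega> \<inter> square r k))) \<partial>M))"

text \<open>
  A square has at most one active transmitter, so power gains are indexed by squares:
  \<open>h (0, 0)\<close> is the gain of the desired link, and \<open>h k\<close> for \<open>k \<noteq> (0, 0)\<close> that of the
  interferer in square \<open>k\<close>, if there is one.
\<close>

locale CA_network = prob_space M
  for M :: "'w measure" +
  fixes lam :: real and r_gz :: real
    and \<Phi> :: "'w \<Rightarrow> plane set" and \<Psi> :: "'w \<Rightarrow> plane set"
    and h :: "int \<times> int \<Rightarrow> 'w \<Rightarrow> real"
  assumes transmitters: "poisson_process M lam \<Phi>"
    and active: "uniform_selection M r_gz \<Phi> \<Psi>"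
    and gains_exponential: "\<And>k. distributed M lborel (h k) (exponential_density 1)"
    and gains_indep: "indep_vars (\<lambda>_. borel) h UNIV"
    and gains_indep_locations:
      "indep_set
         (sets (vimage_algebra (space M) (\<lambda>\<omega>. (\<Phi> \<omega>, \<Psi> \<omega>)) (config_space \<Otimes>\<^sub>M config_space)))
         (sets (vimage_algebra (space M) (\<lambda>\<omega> k. h k \<omega>) (\<Pi>\<^sub>M k\<in>UNIV. borel)))"

text \<open>
  The interference is an infinite sum of nonnegative terms, hence taken in the extended
  nonnegative reals, where it always exists.
\<close>

definition interference ::
    "real \<Rightarrow> real \<Rightarrow> ('w \<Rightarrow> plane set) \<Rightarrow> (int \<times> int \<Rightarrow> 'w \<Rightarrow> real) \<Rightarrow> 'w \<Rightarrow> ennreal" where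
  "interference \<alpha> r_gz \<Psi> h \<omega> =
     (\<Sum>\<^sub>\<infinity>x\<in>\<Psi> \<omega> - square r_gz (0, 0). ennreal (norm x powr (- \<alpha>) * h (square_of r_gz x) \<omega>))"

definition sinr ::
    "real \<Rightarrow> real \<Rightarrow> real \<Rightarrow> real \<Rightarrow> ('w \<Rightarrow> plane set) \<Rightarrow> (int \<times> int \<Rightarrow> 'w \<Rightarrow> real) \<Rightarrow> 'w \<Rightarrow> ennreal" where
  "sinr \<alpha> \<rho> r_tr r_gz \<Psi> h \<omega> =
     ennreal (\<rho> * r_tr powr (- \<alpha>) * h (0, 0) \<omega>) /
     (ennreal \<rho> * interference \<alpha> r_gz \<Psi> h \<omega> + 1)"

definition outage ::
    "'w measure \<Rightarrow> real \<Rightarrow> real \<Rightarrow> real \<Rightarrow> real \<Rightarrow> ('w \<Rightarrow> plane set) \<Rightarrow>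
     (int \<times> int \<Rightarrow> 'w \<Rightarrow> real) \<Rightarrow> real \<Rightarrow> real" where
  "outage M \<alpha> \<rho> r_tr r_gz \<Psi> h \<beta> =
     measure M {\<omega> \<in> space M. sinr \<alpha> \<rho> r_tr r_gz \<Psi> h \<omega> \<le> ennreal \<beta>}"

definition throughput ::
    "'w measure \<Rightarrow> real \<Rightarrow> real \<Rightarrow> real \<Rightarrow> real \<Rightarrow> ('w \<Rightarrow> plane set) \<Rightarrow>
     (int \<times> int \<Rightarrow> 'w \<Rightarrow> real) \<Rightarrow> real \<Rightarrow> real" where
  "throughput M \<alpha> \<rho> r_tr r_gz \<Psi> h \<beta> =
     intensity M \<Psi> * (1 - outage M \<alpha> \<rho> r_tr r_gz \<Psi> h \<beta>)"

end

theory Submission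
  imports Defs
begin

text \<open>
  Condition on the locations. The Rayleigh gain of the desired link turns the coverage event into a
  Laplace transform, and independence of the squares (inherited from the Poisson process) turns that
  into a product over the squares \<open>k\<close> other than the typical one. With \<open>s = \<beta> r\<^sub>t\<^sub>r\<^sup>\<alpha>\<close> and
  \<open>g x = s / (s + |x|\<^sup>\<alpha>)\<close>, the factor of square \<open>k\<close> is \<open>1 - \<lambda> \<integral>\<^sub>k g \<le> exp (- \<lambda> \<integral>\<^sub>k g)\<close>, where
  \<open>\<lambda>\<close> is the intensity of the active transmitters. Finally \<open>g\<close> is radially decreasing, so its
  integral over the typical square is at most its integral over the centered disk of equal area,
  whose radius is \<open>2 r\<^sub>g\<^sub>z / \<surd>\<pi>\<close>; the integrals of \<open>g\<close> over the plane and over this disk are the Gamma and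
  the hypergeometric term.
\<close>

section \<open>Integrals of the path loss over the plane\<close>

text \<open>The active process is not Poisson, so no Poisson Laplace functional is available. It is
  replaced by the fact that the active transmitter of a square exists and lies in \<open>B\<close>
  with probability \<open>lam_CA * |B|\<close>, independently over squares. This rests on the mean
  of \<open>N(B) / N(S)\<close> for Poisson counts, \<open>S\<close> being the square: Mecke's
  identity for \<open>N(B)\<close> gives \<open>lam * |B|\<close> times the mean of
  \<open>1 / (N(S) + 1)\<close>, and the same identity read backwards for \<open>N(S)\<close>
  expresses that mean by the probability that \<open>S\<close> is nonempty. So \<open>lam_CA\<close>
  is this probability divided by the area of \<open>S\<close>.

  Independence yields products only for finite families, while the interference sums over infinitely
  many squares. Dropping squares only lowers the interference, so the bound is shown for finite sets
  of squares and then passed to the supremum.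

  The squared norm serves as radial variable, because its image measure has constant density
  \<open>pi\<close> on the half-line. Hence \<alpha> enters as \<open>p = \<alpha> / 2\<close>, and
  \<open>p > 1\<close> makes the integral over the plane converge.\<close>

lemma distr_norm_squared_plane:
  "distr lborel borel (\<lambda>x :: plane. (norm x)\<^sup>2) =
     density lborel (\<lambda>u. ennreal pi * indicator {0..} u)" (is "?M = ?N")
proof (rule measure_eqI_generator_eq[where E = "range (\<lambda>a :: real. {..a})" and \<Omega> = UNIV
      and A = "\<lambda>n :: nat. {..real n}"])
  show "Int_stable (range (\<lambda>a :: real. {..a}))"
    by (auto simp: Int_stable_def)
  show "emeasure ?M X = emeasure ?N X" if X': "X \<in> range (\<lambda>a :: real. {..a})" for X
  proof -
    obtain a where X: "X = {..a}" using X' by auto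
    have M: "emeasure ?M X = emeasure lborel {x :: plane. (norm x)\<^sup>2 \<le> a}"
      by (subst emeasure_distr) (auto simp: X vimage_def)
    have N: "emeasure ?N X = ennreal pi * emeasure lborel ({0..} \<inter> {..a})"
      by (subst emeasure_density)
         (auto simp: X nn_integral_cmult indicator_inter_arith[symmetric] mult.assoc)
    show ?thesis
    proof (cases "a \<ge> 0")
      case True
      \<comment> \<open>The area \<open>pi * a\<close> of the disk of radius \<open>sqrt a\<close>
        is linear in \<open>a\<close>, whence the constant density.\<close>
      have eq: "{x :: plane. (norm x)\<^sup>2 \<le> a} = cball 0 (sqrt a)"
        using True by (auto simp: real_le_rsqrt real_le_lsqrt) (metis norm_ge_zero power_mono real_sqrt_pow2)
      have "{0..} \<inter> {..a} = {0..a}" by auto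
      then show ?thesis
        unfolding M N eq using True
        by (simp add: emeasure_cball unit_ball_vol_2 ennreal_mult')
    next
      case False
      then have "{x :: plane. (norm x)\<^sup>2 \<le> a} = {}" "{0..} \<inter> {..a} = {}"
        by (auto dest: order_trans[OF zero_le_power2])
      then show ?thesis unfolding M N by (simp only: emeasure_empty mult_zero_right)
    qed
  qed
  show "sets ?M = sigma_sets UNIV (range (\<lambda>a :: real. {..a}))"
    "sets ?N = sigma_sets UNIV (range (\<lambda>a :: real. {..a}))"
    by (simp_all add: borel_eq_atMost)
  show "emeasure ?M {..real n} \<noteq> \<infinity>" for n
  proof -
    have "emeasure ?M {..real n} = emeasure lborel {x :: plane. (norm x)\<^sup>2 \<le> n}"
      by (subst emeasure_distr) (auto simp: vimage_def)
    also have "\<dots> \<le> emeasure lborel (cball 0 (sqrt n) :: plane set)"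
      by (intro emeasure_mono) (auto simp: real_le_rsqrt)
    also have "\<dots> < \<infinity>" by (simp add: emeasure_cball)
    finally show ?thesis by simp
  qed
  show "(\<Union>n. {..real n}) = UNIV"
    by (auto simp: real_arch_simple)
qed auto

lemma nn_integral_plane_radial:
  assumes [measurable]: "f \<in> borel_measurable borel"
  shows "(\<integral>\<^sup>+x. f ((norm x)\<^sup>2) \<partial>(lborel :: plane measure)) =
    ennreal pi * (\<integral>\<^sup>+u. f u * indicator {0..} u \<partial>lborel)"
proof -
  have "(\<integral>\<^sup>+x. f ((norm x)\<^sup>2) \<partial>(lborel :: plane measure)) =
      (\<integral>\<^sup>+u. f u \<partial>distr lborel borel (\<lambda>x :: plane. (norm x)\<^sup>2))"
    by (subst nn_integral_distr) auto
  also have "\<dots> = (\<integral>\<^sup>+u. ennreal pi * (f u * indicator {0..} u) \<partial>lborel)"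
    by (simp add: distr_norm_squared_plane nn_integral_density mult_ac)
  also have "\<dots> = ennreal pi * (\<integral>\<^sup>+u. f u * indicator {0..} u \<partial>lborel)"
    by (rule nn_integral_cmult) auto
  finally show ?thesis .
qed

lemma ratio_gt_iff:
  fixes s p u t :: real
  assumes "s > 0" "p > 0" "u \<ge> 0" "0 < t" "t < 1"
  shows "t < s / (s + u powr p) \<longleftrightarrow> u < (s * (1 - t) / t) powr (1 / p)"
proof -
  have pos: "s + u powr p > 0" using assms by (simp add: add_pos_nonneg)
  have "t < s / (s + u powr p) \<longleftrightarrow> u powr p < s * (1 - t) / t"
    using assms pos by (simp add: field_simps)
  also have "\<dots> \<longleftrightarrow> (u powr p) powr (1 / p) < (s * (1 - t) / t) powr (1 / p)"
    using assms by (metis powr_ge_zero powr_less_mono2 powr_less_cancel2 zero_less_divide_1_iff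
        divide_nonneg_pos less_eq_real_def mult_nonneg_nonneg diff_ge_0_iff_ge linorder_not_less powr_mono2)
  also have "(u powr p) powr (1 / p) = u" using assms by (simp add: powr_powr)
  finally show ?thesis .
qed

text \<open>Layer cake: the superlevel set of the integrand at height \<open>t\<close> is an interval of
  length \<open>(s * (1 - t) / t) powr (1 / p)\<close>, which turns the integral into a Beta integral.\<close>

lemma nn_integral_ratio_powr:
  fixes s p :: real
  assumes "s > 0" "p > 1"
  shows "(\<integral>\<^sup>+u. ennreal (s / (s + u powr p)) * indicator {0..} u \<partial>lborel) =
    ennreal (s powr (1 / p) * Beta (1 - 1 / p) (1 + 1 / p))"
proof -
  let ?I = "\<lambda>(u :: real, t :: real). indicator {x :: real \<times> real. 0 \<le> fst x \<and> 0 < snd x \<and> snd x < 1 \<and> snd x < s / (s + fst x powr p)} (u, t) :: ennreal"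
  have meas: "{x :: real \<times> real. 0 \<le> fst x \<and> 0 < snd x \<and> snd x < 1 \<and> snd x < s / (s + fst x powr p)} \<in> sets (borel \<Otimes>\<^sub>M borel)"
  proof -
    have "Measurable.pred (borel \<Otimes>\<^sub>M borel)
        (\<lambda>x :: real \<times> real. 0 \<le> fst x \<and> 0 < snd x \<and> snd x < 1 \<and> snd x < s / (s + fst x powr p))"
      by measurable
    then show ?thesis by (simp add: pred_def space_pair_measure)
  qed
  have [measurable]: "?I \<in> borel_measurable (lborel \<Otimes>\<^sub>M lborel)"
    using meas by simp
  have "(\<integral>\<^sup>+u. ennreal (s / (s + u powr p)) * indicator {0..} u \<partial>lborel) =
      (\<integral>\<^sup>+u. \<integral>\<^sup>+t. ?I (u, t) \<partial>lborel \<partial>lborel)"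
  proof (rule nn_integral_cong)
    fix u :: real
    show "ennreal (s / (s + u powr p)) * indicator {0..} u = (\<integral>\<^sup>+t. ?I (u, t) \<partial>lborel)"
    proof (cases "u \<ge> 0")
      case True
      have le1: "s / (s + u powr p) \<le> 1"
        using assms by (simp add: divide_le_eq_1 add_pos_nonneg)
      have "(\<integral>\<^sup>+t. ?I (u, t) \<partial>lborel) = (\<integral>\<^sup>+t. indicator {0<..<s / (s + u powr p)} t \<partial>lborel)"
        using True le1 by (intro nn_integral_cong) (auto simp: indicator_def)
      also have "\<dots> = ennreal (s / (s + u powr p))"
        using assms by simp
      finally show ?thesis using True by simp
    next
      case False
      then have "?I (u, t) = 0" for t by (auto simp: indicator_def)
      then show ?thesis using False by simp
    qed
  qed
  also have "\<dots> = (\<integral>\<^sup>+t. \<integral>\<^sup>+u. ?I (u, t) \<partial>lborel \<partial>lborel)"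
    by (rule lborel_pair.Fubini') simp
  also have "\<dots> = (\<integral>\<^sup>+t. ennreal (s powr (1 / p) * (t powr ((1 - 1 / p) - 1) * (1 - t) powr ((1 + 1 / p) - 1))) *
      indicator {0..1} t \<partial>lborel)"
  proof (rule nn_integral_cong_AE)
    have "AE t in lborel. t \<noteq> (0 :: real)" "AE t in lborel. t \<noteq> (1 :: real)"
      by (auto intro: AE_lborel_singleton)
    then show "AE t in lborel. (\<integral>\<^sup>+u. ?I (u, t) \<partial>lborel) =
      ennreal (s powr (1 / p) * (t powr ((1 - 1 / p) - 1) * (1 - t) powr ((1 + 1 / p) - 1))) *
      indicator {0..1} t"
    proof eventually_elim
      case (elim t)
      show ?case
      proof (cases "0 < t \<and> t < 1")
        case True
        have "(\<integral>\<^sup>+u. ?I (u, t) \<partial>lborel) =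
            (\<integral>\<^sup>+u. indicator {0..<(s * (1 - t) / t) powr (1 / p)} u \<partial>lborel)"
          using True assms ratio_gt_iff[of s p _ t]
          by (intro nn_integral_cong) (auto simp: indicator_def)
        also have "\<dots> = ennreal ((s * (1 - t) / t) powr (1 / p))"
          by simp
        also have "(s * (1 - t) / t) powr (1 / p) =
            s powr (1 / p) * (t powr ((1 - 1 / p) - 1) * (1 - t) powr ((1 + 1 / p) - 1))"
          using True assms by (simp add: powr_mult powr_divide powr_minus_divide)
        finally show ?thesis using True by simp
      next
        case False
        then have "?I (u, t) = 0" for u by (auto simp: indicator_def)
        then show ?thesis using False elim by (auto simp: indicator_def)
      qed
    qed
  qed
  also have "\<dots> = ennreal (s powr (1 / p) * Beta (1 - 1 / p) (1 + 1 / p))"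
  proof -
    \<comment> \<open>Here \<open>p > 1\<close> enters: it makes \<open>1 - 1 / p\<close> positive.
      The singularity at \<open>t = 0\<close> reflects the decay of the integrand for large
      \<open>u\<close>.\<close>
    have "((\<lambda>t. s powr (1 / p) * (t powr ((1 - 1 / p) - 1) * (1 - t) powr ((1 + 1 / p) - 1))) has_integral
      (s powr (1 / p) * Beta (1 - 1 / p) (1 + 1 / p))) {0..1}"
      using assms by (intro has_integral_mult_right has_integral_Beta_real) (auto simp: add_pos_pos)
    then show ?thesis
      by (intro nn_integral_has_integral_lebesgue') auto
  qed
  finally show ?thesis .
qed

text \<open>The substitution \<open>t = v powr p\<close> removes the endpoint singularity from Euler's integral
  representation of the hypergeometric function.\<close>

lemma hyp2F1_integral:
  fixes p :: real
  assumes p: "p > 0" and z: "z \<in> hyp2F1_domain"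
  shows "hyp2F1 (of_real (1 / p)) 1 (1 + of_real (1 / p)) z =
    integral (cbox 0 1) (\<lambda>v. 1 / (1 - z * of_real (v powr p)))"
proof (rule hyp2F1_eqI[OF _ _ z])
  let ?f = "\<lambda>z. integral (cbox 0 1) (\<lambda>v. 1 / (1 - z * complex_of_real (v powr p)))"
  have "closed {z. Im z = 0 \<and> 1 \<le> Re z}"
    by (intro closed_Collect_conj closed_Collect_eq closed_Collect_le continuous_intros)
  then have op: "open hyp2F1_domain" by (simp add: hyp2F1_domain_def open_Compl)
  \<comment> \<open>The denominator vanishes only for \<open>z = 1 / (v powr p)\<close>, a real
    number that is at least 1, hence only on the cut. So Euler's integral makes sense on the whole
    domain.\<close>
  have nz: "1 - z * complex_of_real (v powr p) \<noteq> 0" if z: "z \<in> hyp2F1_domain" and v: "v \<in> cbox 0 1" for z v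
  proof
    assume eq: "1 - z * complex_of_real (v powr p) = 0"
    then have *: "z * complex_of_real (v powr p) = 1" by simp
    then have w: "v powr p \<noteq> 0" by auto
    have w1: "v powr p \<le> 1" "v powr p > 0" using v p w by (auto intro: powr_le1)
    have "z = complex_of_real (1 / (v powr p))" using * w by (simp add: field_simps)
    then have "Im z = 0" "Re z \<ge> 1" using w1 by auto
    then show False using z by (simp add: hyp2F1_domain_def)
  qed
  have cp: "continuous_on (cbox 0 1) (\<lambda>v. complex_of_real (v powr p))"
    using p by (intro continuous_intros continuous_on_powr') auto
  have int: "(\<lambda>v. 1 / (1 - z * complex_of_real (v powr p))) integrable_on cbox 0 1"
    if "z \<in> hyp2F1_domain" for z
    using nz[OF that] by (intro integrable_continuous continuous_intros cp) auto
  \<comment> \<open>Holomorphy is local, and on a ball inside the open domain differentiation under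
    the integral sign is justified.\<close>
  show "?f holomorphic_on hyp2F1_domain"
  proof (rule holomorphic_on_subset[OF _ subset_refl], subst holomorphic_on_open[OF op], intro ballI)
    fix z assume "z \<in> hyp2F1_domain"
    then obtain e where e: "e > 0" "ball z e \<subseteq> hyp2F1_domain"
      using op openE by blast
    have "?f holomorphic_on ball z e"
    proof (rule leibniz_rule_holomorphic)
      show "((\<lambda>x. 1 / (1 - x * complex_of_real (t powr p))) has_field_derivative
          complex_of_real (t powr p) / (1 - x * complex_of_real (t powr p))\<^sup>2) (at x within ball z e)"
        if "x \<in> ball z e" "t \<in> cbox 0 1" for x t
        using nz[of x t] e that
        by (auto intro!: derivative_eq_intros simp: power2_eq_square)
      show "(\<lambda>v. 1 / (1 - x * complex_of_real (v powr p))) integrable_on cbox 0 1"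
        if "x \<in> ball z e" for x using int e that by auto
      have c2: "continuous_on (ball z e \<times> cbox 0 1) (\<lambda>x. complex_of_real (snd x powr p))"
        by (rule continuous_on_compose2[OF cp continuous_on_snd[OF continuous_on_id]]) auto
      show "continuous_on (ball z e \<times> cbox 0 1)
          (\<lambda>(x, t). complex_of_real (t powr p) / (1 - x * complex_of_real (t powr p))\<^sup>2)"
        unfolding case_prod_beta
      proof (intro continuous_on_divide continuous_on_power continuous_on_diff continuous_on_mult
          continuous_on_const continuous_on_fst continuous_on_id c2 ballI)
        fix x assume "x \<in> ball z e \<times> cbox (0 :: real) 1"
        then show "(1 - fst x * complex_of_real (snd x powr p))\<^sup>2 \<noteq> 0"
          using nz[of "fst x" "snd x"] e by (simp add: mem_Times_iff subset_iff)
      qed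
    qed auto
    then show "\<exists>f'. (?f has_field_derivative f') (at z)"
      using e by (meson centre_in_ball holomorphic_on_open open_ball)
  qed
  fix u :: complex assume "u \<in> ball 0 1"
  then have u: "norm u < 1" by simp
  then have "\<bar>Re u\<bar> < 1" using abs_Re_le_cmod[of u] by linarith
  then have ud: "u \<in> hyp2F1_domain" by (auto simp: hyp2F1_domain_def)
  \<comment> \<open>The parameter 1 cancels the factorial, and
    \<open>pochhammer a n / pochhammer (1 + a) n\<close> telescopes to \<open>a / (a + n)\<close>.
    For \<open>a = 1 / p\<close> this is the integral of the \<open>n\<close>-th power of
    \<open>v powr p\<close> over the unit interval.\<close>
  have coeff: "fps_nth (fps_hypergeo [complex_of_real (1 / p), 1] [1 + complex_of_real (1 / p)] 1) n =
      1 / (1 + of_nat n * of_real p)" for n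
  proof -
    have nn: "complex_of_real (1 / p) + of_nat k \<noteq> 0" for k
    proof -
      have "1 / p + real k > 0" using p by (simp add: add_pos_nonneg)
      then have "complex_of_real (1 / p + real k) \<noteq> 0" by (simp only: of_real_eq_0_iff)
      then show ?thesis by simp
    qed
    have ne: "pochhammer (1 + complex_of_real (1 / p)) n \<noteq> 0"
    proof
      assume "pochhammer (1 + complex_of_real (1 / p)) n = 0"
      then obtain k where k: "1 + complex_of_real (1 / p) = - of_nat k"
        by (auto simp: pochhammer_eq_0_iff)
      then have "complex_of_real (1 / p) + of_nat (Suc k) = 0"
        by (simp add: eq_neg_iff_add_eq_0 algebra_simps)
      then show False using nn[of "Suc k"] by blast
    qed
    have "pochhammer (complex_of_real (1 / p)) (Suc n) =
        complex_of_real (1 / p) * pochhammer (1 + complex_of_real (1 / p)) n"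
      by (simp add: pochhammer_rec add.commute)
    moreover have "pochhammer (complex_of_real (1 / p)) (Suc n) =
        pochhammer (complex_of_real (1 / p)) n * (complex_of_real (1 / p) + of_nat n)"
      by (rule pochhammer_Suc)
    ultimately have "pochhammer (complex_of_real (1 / p)) n / pochhammer (1 + complex_of_real (1 / p)) n =
       complex_of_real (1 / p) / (complex_of_real (1 / p) + of_nat n)"
      using frac_eq_eq[OF ne nn[of n]] by (simp only: mult.commute)
    also have "\<dots> = 1 / (1 + of_nat n * of_real p)"
      using p by (simp add: divide_simps)
    finally show ?thesis by (simp add: pochhammer_fact[symmetric])
  qed
  define S where "S N = (\<Sum>n<N. u ^ n * (1 / (1 + of_nat n * complex_of_real p)))" for N
  have pw: "((\<lambda>v. complex_of_real (v powr p) ^ n) has_integral 1 / (1 + of_nat n * of_real p)) (cbox 0 1)" for n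
  proof -
    have np: "real n * p > -1" using p by (metis less_le_trans mult_nonneg_nonneg of_nat_0_le_iff less_imp_le neg_less_0_iff_less zero_less_one)
    have "((\<lambda>v. v powr (real n * p)) has_integral 1 / (real n * p + 1)) {0..1}"
      using has_integral_powr_from_0[OF np, of 1] by simp
    then have "((\<lambda>v. complex_of_real (v powr (real n * p))) has_integral of_real (1 / (real n * p + 1))) {0..1}"
      by (rule has_integral_of_real)
    \<comment> \<open>The point 0 is left out because of \<open>n = 0\<close>: there
      \<open>0 powr 0\<close> is 0, whereas the zeroth power is 1.\<close>
    moreover have "complex_of_real (v powr (real n * p)) = complex_of_real (v powr p) ^ n" if "v \<in> {0..1} - {0}" for v
    proof -
      have "v powr (real n * p) = (v powr p) ^ n"
        using that by (simp add: powr_powr powr_realpow[symmetric] mult.commute)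
      then show ?thesis by simp
    qed
    ultimately have "((\<lambda>v. complex_of_real (v powr p) ^ n) has_integral of_real (1 / (real n * p + 1))) {0..1}"
      by (intro has_integral_spike_finite[of "{0}" "{0..1}" "\<lambda>v. complex_of_real (v powr p) ^ n"]) auto
    then show ?thesis by (simp add: add.commute)
  qed
  \<comment> \<open>The truncated geometric series leaves the exact remainder
    \<open>?w ^ N / (1 - ?w)\<close>; bounding it uniformly in \<open>v\<close> replaces an exchange
    of sum and integral.\<close>
  have bound: "norm (?f u - S N) \<le> norm u ^ N / (1 - norm u)" for N
  proof -
    have SN: "((\<lambda>v. \<Sum>n<N. u ^ n * complex_of_real (v powr p) ^ n) has_integral S N) (cbox 0 1)"
      unfolding S_def by (intro has_integral_sum has_integral_mult_right pw) auto
    have "((\<lambda>v. 1 / (1 - u * complex_of_real (v powr p)) - (\<Sum>n<N. u ^ n * complex_of_real (v powr p) ^ n))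
        has_integral ?f u - S N) (cbox 0 1)"
      by (intro has_integral_diff SN integrable_integral int ud)
    then have "norm (?f u - S N) \<le> norm u ^ N / (1 - norm u) * measure lborel (cbox 0 (1 :: real))"
    proof (rule has_integral_bound[rotated])
      show "norm u ^ N / (1 - norm u) \<ge> 0" using u by simp
      fix v :: real assume v: "v \<in> cbox 0 1"
      let ?w = "u * complex_of_real (v powr p)"
      have w: "norm ?w \<le> norm u"
        using v p by (auto simp: norm_mult intro!: mult_left_le powr_le1)
      have "1 - norm u \<le> norm (1 - ?w)"
        using norm_triangle_ineq2[of 1 ?w] w by simp
      moreover have "1 / (1 - ?w) - (\<Sum>n<N. u ^ n * complex_of_real (v powr p) ^ n) = ?w ^ N / (1 - ?w)"
      proof -
        have "?w \<noteq> 1" using nz[OF ud v] by auto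
        then have "(\<Sum>n<N. ?w ^ n) = (1 - ?w ^ N) / (1 - ?w)"
          using sum_gp_strict[of ?w N] by simp
        then have "(\<Sum>n<N. u ^ n * complex_of_real (v powr p) ^ n) = (1 - ?w ^ N) / (1 - ?w)"
          by (simp only: power_mult_distrib)
        then show ?thesis by (simp only: diff_divide_distrib[symmetric]) simp
      qed
      moreover have "norm (?w ^ N) \<le> norm u ^ N"
        unfolding norm_power using w by (intro power_mono) auto
      ultimately show "norm (1 / (1 - ?w) - (\<Sum>n<N. u ^ n * complex_of_real (v powr p) ^ n)) \<le> norm u ^ N / (1 - norm u)"
        using u by (simp only: norm_divide) (intro frac_le; simp)
    qed
    then show ?thesis by simp
  qed
  have "(\<lambda>N. norm u ^ N / (1 - norm u)) \<longlonglongrightarrow> 0"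
    using u by (intro tendsto_divide_zero LIMSEQ_power_zero) simp
  then have "(\<lambda>N. ?f u - S N) \<longlonglongrightarrow> 0"
    by (rule Lim_null_comparison[rotated]) (intro always_eventually allI bound)
  then have "(\<lambda>N. ?f u - (?f u - S N)) \<longlonglongrightarrow> ?f u - 0"
    by (rule tendsto_diff[OF tendsto_const])
  then have "(\<lambda>N. S N) \<longlonglongrightarrow> ?f u" by (simp only: diff_zero diff_diff_eq2 add_diff_cancel_left')
  then have "(\<lambda>n. u ^ n * (1 / (1 + of_nat n * complex_of_real p))) sums ?f u"
    unfolding sums_def S_def .
  then show "?f u = eval_fps (fps_hypergeo [complex_of_real (1 / p), 1] [1 + complex_of_real (1 / p)] 1) u"
    unfolding eval_fps_def coeff by (simp add: sums_iff mult.commute)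
qed

text \<open>A nonpositive argument stays off the cut and makes the integrand of Euler's integral
  real, so taking the real part loses nothing.\<close>

lemma hyp2F1_real_integral:
  fixes p y :: real
  assumes p: "p > 0" and y: "y \<ge> 0"
  shows "((\<lambda>v. 1 / (1 + y * v powr p)) has_integral hyp2F1_real (1 / p) 1 (1 + 1 / p) (- y)) {0..1}"
proof -
  have pos: "1 + y * v powr p > 0" for v using y by (simp add: add_pos_nonneg)
  have "continuous_on {0..1} (\<lambda>v. 1 / (1 + y * v powr p))"
    using p by (intro continuous_intros continuous_on_powr') (auto simp: pos less_imp_neq[OF pos, symmetric])
  then have int: "((\<lambda>v. 1 / (1 + y * v powr p)) has_integral integral {0..1} (\<lambda>v. 1 / (1 + y * v powr p))) {0..1}"
    by (intro integrable_integral integrable_continuous_real)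
  have "((\<lambda>v. complex_of_real (1 / (1 + y * v powr p))) has_integral
      complex_of_real (integral {0..1} (\<lambda>v. 1 / (1 + y * v powr p)))) {0..1}"
    by (rule has_integral_of_real[OF int])
  then have "((\<lambda>v. 1 / (1 - complex_of_real (- y) * complex_of_real (v powr p))) has_integral
      complex_of_real (integral {0..1} (\<lambda>v. 1 / (1 + y * v powr p)))) {0..1}"
    by simp
  then have "integral (cbox 0 1) (\<lambda>v. 1 / (1 - complex_of_real (- y) * complex_of_real (v powr p))) =
      complex_of_real (integral {0..1} (\<lambda>v. 1 / (1 + y * v powr p)))"
    by (simp only: box_real integral_unique)
  moreover have "complex_of_real (- y) \<in> hyp2F1_domain"
    using y by (simp add: hyp2F1_domain_def)
  ultimately have "hyp2F1_real (1 / p) 1 (1 + 1 / p) (- y) = integral {0..1} (\<lambda>v. 1 / (1 + y * v powr p))"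
    using hyp2F1_integral[OF p, of "complex_of_real (- y)"] by (simp add: hyp2F1_real_def)
  then show ?thesis using int by simp
qed

text \<open>In terms of the squared norm \<open>u\<close> the disk is the interval from 0 to
  \<open>R\<^sup>2\<close>, and the scaling \<open>u = R\<^sup>2 * v\<close> produces Euler's
  integral.\<close>

lemma nn_integral_disk_ratio:
  fixes s p R :: real
  assumes "s > 0" "p > 1" "R > 0"
  shows "(\<integral>\<^sup>+x. ennreal (s / (s + ((norm x)\<^sup>2) powr p)) * indicator (cball 0 R) x \<partial>(lborel :: plane measure)) =
    ennreal (pi * R\<^sup>2 * hyp2F1_real (1 / p) 1 (1 + 1 / p) (- ((R\<^sup>2) powr p / s)))"
proof -
  let ?f = "\<lambda>u. ennreal (s / (s + u powr p)) * indicator {..R\<^sup>2} u"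
  let ?y = "(R\<^sup>2) powr p / s"
  have R2: "R\<^sup>2 > 0" and y: "?y \<ge> 0" using assms by auto
  note hi = hyp2F1_real_integral[of p ?y]
  have "(\<integral>\<^sup>+x. ennreal (s / (s + ((norm x)\<^sup>2) powr p)) * indicator (cball 0 R) x \<partial>(lborel :: plane measure)) =
      (\<integral>\<^sup>+x. ?f ((norm x)\<^sup>2) \<partial>(lborel :: plane measure))"
    using assms by (intro nn_integral_cong) (auto simp: indicator_def abs_le_square_iff[symmetric])
  also have "\<dots> = ennreal pi * (\<integral>\<^sup>+u. ?f u * indicator {0..} u \<partial>lborel)"
    by (rule nn_integral_plane_radial) measurable
  also have "(\<integral>\<^sup>+u. ?f u * indicator {0..} u \<partial>lborel) =
      ennreal (R\<^sup>2) * (\<integral>\<^sup>+v. ?f (0 + R\<^sup>2 * v) * indicator {0..} (0 + R\<^sup>2 * v) \<partial>lborel)"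
    using R2 by (subst nn_integral_real_affine[where c = "R\<^sup>2" and t = 0]) auto
  also have "(\<integral>\<^sup>+v. ?f (0 + R\<^sup>2 * v) * indicator {0..} (0 + R\<^sup>2 * v) \<partial>lborel) =
      (\<integral>\<^sup>+v. ennreal (1 / (1 + ?y * v powr p)) * indicator {0..1} v \<partial>lborel)"
  proof (rule nn_integral_cong)
    fix v :: real
    show "?f (0 + R\<^sup>2 * v) * indicator {0..} (0 + R\<^sup>2 * v) =
        ennreal (1 / (1 + ?y * v powr p)) * indicator {0..1} v"
    proof (cases "0 \<le> v \<and> v \<le> 1")
      case True
      then have "R\<^sup>2 * v \<le> R\<^sup>2" "R\<^sup>2 * v \<ge> 0" using R2 by (auto simp: mult_left_le)
      moreover have "s / (s + (R\<^sup>2 * v) powr p) = 1 / (1 + ?y * v powr p)"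
        using True R2 assms by (simp add: powr_mult divide_simps)
      ultimately show ?thesis using True by simp
    next
      case False
      then have "R\<^sup>2 * v > R\<^sup>2 \<or> R\<^sup>2 * v < 0"
        using R2 by (auto simp: mult_less_0_iff)
      then show ?thesis using False R2 by (auto simp: indicator_def)
    qed
  qed
  also have "\<dots> = ennreal (hyp2F1_real (1 / p) 1 (1 + 1 / p) (- ?y))"
    using assms hi y by (intro nn_integral_has_integral_lebesgue') (auto simp: add_nonneg_nonneg)
  also have "ennreal pi * (ennreal (R\<^sup>2) * ennreal (hyp2F1_real (1 / p) 1 (1 + 1 / p) (- ?y))) =
      ennreal (pi * R\<^sup>2 * hyp2F1_real (1 / p) 1 (1 + 1 / p) (- ?y))"
    by (simp add: ennreal_mult'[symmetric] mult.assoc)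
  finally show ?thesis .
qed

text \<open>The bathtub principle: the common part \<open>A \<inter> B\<close> cancels, and the
  remainders \<open>A - B\<close> and \<open>B - A\<close> have equal measure, with the level
  \<open>c\<close> separating the values of \<open>f\<close> on them. For a radially decreasing
  \<open>f\<close> and a centered disk \<open>B\<close>, the value on the boundary circle is such a
  level.\<close>

lemma nn_integral_bathtub:
  fixes f :: "'a \<Rightarrow> ennreal"
  assumes [measurable]: "f \<in> borel_measurable N" "A \<in> sets N" "B \<in> sets N"
    and eq: "emeasure N A = emeasure N B" and fin: "emeasure N B \<noteq> \<infinity>"
    and le: "\<And>x. x \<in> A - B \<Longrightarrow> f x \<le> c" and ge: "\<And>x. x \<in> B - A \<Longrightarrow> c \<le> f x"
  shows "(\<integral>\<^sup>+x. f x * indicator A x \<partial>N) \<le> (\<integral>\<^sup>+x. f x * indicator B x \<partial>N)"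
proof -
  have split: "(\<integral>\<^sup>+x. f x * indicator U x \<partial>N) =
      (\<integral>\<^sup>+x. f x * indicator (U \<inter> V) x \<partial>N) + (\<integral>\<^sup>+x. f x * indicator (U - V) x \<partial>N)"
    if [measurable]: "U \<in> sets N" "V \<in> sets N" for U V
    by (subst nn_integral_add[symmetric]) (auto intro!: nn_integral_cong simp: indicator_def)
  \<comment> \<open>Finiteness permits subtracting the measure of the common part from both
    sides.\<close>
  have fin': "emeasure N (A \<inter> B) \<noteq> \<infinity>"
    using fin emeasure_mono[of "A \<inter> B" B N] by (auto simp: top_unique)
  have "emeasure N (A - B) = emeasure N A - emeasure N (A \<inter> B)"
    using fin' by (subst emeasure_Diff[symmetric]) (auto intro: arg_cong[where f = "emeasure N"])
  also have "\<dots> = emeasure N (B - A)"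
    unfolding eq using fin' by (subst emeasure_Diff[symmetric]) (auto intro: arg_cong[where f = "emeasure N"])
  finally have diff: "emeasure N (A - B) = emeasure N (B - A)" .
  have "(\<integral>\<^sup>+x. f x * indicator (A - B) x \<partial>N) \<le> (\<integral>\<^sup>+x. c * indicator (A - B) x \<partial>N)"
    using le by (intro nn_integral_mono) (auto simp: indicator_def)
  also have "\<dots> = (\<integral>\<^sup>+x. c * indicator (B - A) x \<partial>N)"
    by (simp add: nn_integral_cmult diff)
  also have "\<dots> \<le> (\<integral>\<^sup>+x. f x * indicator (B - A) x \<partial>N)"
    using ge by (intro nn_integral_mono) (auto simp: indicator_def)
  finally show ?thesis
    using split[of A B] split[of B A] by (simp add: Int_commute add_left_mono)
qed

text \<open>The integral over the plane splits into the parts on \<open>S\<close> and on its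
  complement; the bathtub comparison with the disk of equal area bounds the first part from above,
  hence the second from below.\<close>

lemma nn_integral_outside_ge:
  fixes s p R :: real and S :: "plane set"
  assumes "s > 0" "p > 1" "R > 0" and S: "S \<in> sets borel" "emeasure lborel S = ennreal (pi * R\<^sup>2)"
  shows "ennreal (pi * (s powr (1 / p) * Beta (1 - 1 / p) (1 + 1 / p)) -
      pi * R\<^sup>2 * hyp2F1_real (1 / p) 1 (1 + 1 / p) (- ((R\<^sup>2) powr p / s)))
    \<le> (\<integral>\<^sup>+x. ennreal (s / (s + ((norm x)\<^sup>2) powr p)) * indicator (- S) x \<partial>lborel)"
proof -
  let ?g = "\<lambda>x :: plane. ennreal (s / (s + ((norm x)\<^sup>2) powr p))"
  let ?T = "pi * (s powr (1 / p) * Beta (1 - 1 / p) (1 + 1 / p))"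
  let ?D = "pi * R\<^sup>2 * hyp2F1_real (1 / p) 1 (1 + 1 / p) (- ((R\<^sup>2) powr p / s))"
  have [measurable]: "S \<in> sets lborel" using S by simp
  have mono: "s / (s + (a\<^sup>2) powr p) \<le> s / (s + (b\<^sup>2) powr p)" if "0 \<le> b" "b \<le> a" for a b
    using that assms by (intro divide_left_mono add_left_mono powr_mono2 power_mono mult_pos_pos add_pos_nonneg) auto
  \<comment> \<open>Nonnegativity of the subtrahend is what lets the difference in
    \<open>ennreal\<close> be rewritten as \<open>ennreal\<close> of the real difference.\<close>
  have D0: "?D \<ge> 0"
    using assms by (intro mult_nonneg_nonneg has_integral_nonneg[OF hyp2F1_real_integral])
      (auto simp: add_nonneg_nonneg)
  have "ennreal ?T = ennreal pi * ennreal (s powr (1 / p) * Beta (1 - 1 / p) (1 + 1 / p))"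
    by (rule ennreal_mult') simp
  also have "\<dots> = (\<integral>\<^sup>+x. ?g x \<partial>lborel)"
    using assms nn_integral_plane_radial[of "\<lambda>u. ennreal (s / (s + u powr p))"]
    by (simp add: nn_integral_ratio_powr)
  also have "\<dots> = (\<integral>\<^sup>+x. ?g x * indicator S x \<partial>lborel) + (\<integral>\<^sup>+x. ?g x * indicator (- S) x \<partial>lborel)"
    by (subst nn_integral_add[symmetric]) (auto intro!: nn_integral_cong simp: indicator_def)
  also have "(\<integral>\<^sup>+x. ?g x * indicator S x \<partial>lborel) \<le> (\<integral>\<^sup>+x. ?g x * indicator (cball 0 R) x \<partial>lborel)"
  proof (rule nn_integral_bathtub)
    show "emeasure lborel S = emeasure lborel (cball 0 R :: plane set)"
      using S assms by (simp add: emeasure_cball unit_ball_vol_2 power2_eq_square)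
    show "emeasure lborel (cball 0 R :: plane set) \<noteq> \<infinity>"
      using assms by (simp add: emeasure_cball)
    show "?g x \<le> ennreal (s / (s + (R\<^sup>2) powr p))" if "x \<in> S - cball 0 R" for x
      using that assms by (intro ennreal_leI mono) auto
    show "ennreal (s / (s + (R\<^sup>2) powr p)) \<le> ?g x" if "x \<in> cball 0 R - S" for x
      using that assms by (intro ennreal_leI mono) auto
  qed (use S in auto)
  also have "(\<integral>\<^sup>+x. ?g x * indicator (cball 0 R) x \<partial>lborel) = ennreal ?D"
    by (rule nn_integral_disk_ratio) fact+
  finally have "ennreal ?T \<le> ennreal ?D + (\<integral>\<^sup>+x. ?g x * indicator (- S) x \<partial>lborel)"
    by (simp add: add_right_mono)
  then have "ennreal ?T - ennreal ?D \<le> (\<integral>\<^sup>+x. ?g x * indicator (- S) x \<partial>lborel)"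
    by (simp add: ennreal_minus_le_iff)
  then show ?thesis using D0 by (simp only: ennreal_minus)
qed

section \<open>Counting transmitters in squares\<close>

lemma sets_square [measurable]: "square r k \<in> sets borel"
  unfolding square_def borel_prod[symmetric] by (intro pair_measureI) auto

lemma bounded_square: "bounded (square r k)"
  unfolding square_def by (intro bounded_Times) (auto intro: bounded_subset[OF bounded_closed_interval])

lemma emeasure_square:
  assumes "r > 0"
  shows "emeasure lborel (square r k) = ennreal (4 * r\<^sup>2)"
proof -
  have "emeasure lborel (square r k) = emeasure (lborel \<Otimes>\<^sub>M lborel) (square r k)"
    by (simp add: lborel_prod)
  also have "\<dots> = ennreal (2 * r) * ennreal (2 * r)"
    unfolding square_def using assms by (subst lborel.emeasure_pair_measure_Times) auto
  also have "\<dots> = ennreal (4 * r\<^sup>2)"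
    using assms by (simp add: ennreal_mult[symmetric] power2_eq_square)
  finally show ?thesis .
qed

lemma disjoint_squares:
  assumes "r > 0" "k \<noteq> l"
  shows "square r k \<inter> square r l = {}"
  using assms by (auto simp: in_square_iff)

lemma space_config_space: "space config_space = configurations"
  unfolding config_space_def by (intro space_measure_of) auto

lemma finite_configuration_Int: "S \<in> space config_space \<Longrightarrow> bounded B \<Longrightarrow> finite (S \<inter> B)"
  by (simp add: space_config_space configurations_def)

lemma measurable_card_Int:
  assumes "B \<in> sets borel" "bounded B"
  shows "(\<lambda>S. card (S \<inter> B)) \<in> config_space \<rightarrow>\<^sub>M count_space UNIV"
proof -
  have "(\<lambda>S. card (S \<inter> B)) -` {n} \<inter> space config_space \<in> sets config_space" for n
  proof -
    have "(\<lambda>S. card (S \<inter> B)) -` {n} \<inter> space config_space = {S \<in> configurations. card (S \<inter> B) = n}"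
      by (auto simp: space_config_space)
    also have "\<dots> \<in> sets config_space"
      unfolding config_space_def using assms by (intro in_measure_of) auto
    finally show ?thesis .
  qed
  then show ?thesis by (subst measurable_count_space_eq2_countable) auto
qed

lemma nn_integral_nat_measure:
  fixes D :: "nat measure"
  assumes "sets D = UNIV"
  shows "(\<integral>\<^sup>+n. f n \<partial>D) = (\<Sum>n. f n * emeasure D {n})"
proof -
  have meas: "g \<in> borel_measurable D" for g :: "nat \<Rightarrow> ennreal"
    using assms sets_eq_imp_space_eq[of D "count_space UNIV"] by (simp add: measurable_def)
  have "f n = (\<Sum>m. f m * indicator {m} n)" for n
    by (subst suminf_finite[of "{n}"]) (auto simp: indicator_def)
  then have "(\<integral>\<^sup>+n. f n \<partial>D) = (\<integral>\<^sup>+n. (\<Sum>m. f m * indicator {m} n) \<partial>D)"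
    by (rule nn_integral_cong)
  also have "\<dots> = (\<Sum>m. f m * emeasure D {m})"
    using assms meas by (subst nn_integral_suminf) (auto simp: nn_integral_cmult)
  finally show ?thesis .
qed

text \<open>Mecke's identity for a Poisson count of mean \<open>a\<close>. Since
  \<open>n * a ^ n / fact n = a * a ^ (n - 1) / fact (n - 1)\<close> for positive \<open>n\<close>,
  a factor \<open>n\<close> is traded for one added point.\<close>

lemma mecke_poisson:
  fixes D :: "nat measure"
  assumes "sets D = UNIV" "a \<ge> 0"
    and "\<And>n. emeasure D {n} = ennreal (a ^ n / fact n * exp (- a))"
  shows "(\<integral>\<^sup>+n. of_nat n * f n \<partial>D) = ennreal a * (\<integral>\<^sup>+n. f (Suc n) \<partial>D)"
proof -
  have eq: "of_nat (Suc n) * f (Suc n) * emeasure D {Suc n} = ennreal a * (f (Suc n) * emeasure D {n})" for n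
  proof -
    have "of_nat (Suc n) * emeasure D {Suc n} =
        ennreal (real (Suc n) * (a ^ Suc n / fact (Suc n) * exp (- a)))"
      unfolding assms(3) ennreal_of_nat_eq_real_of_nat by (rule ennreal_mult[symmetric]) (use assms in auto)
    also have "real (Suc n) * (a ^ Suc n / fact (Suc n) * exp (- a)) = a * (a ^ n / fact n * exp (- a))"
      by (simp add: fact_Suc divide_simps del: of_nat_Suc)
    also have "ennreal \<dots> = ennreal a * emeasure D {n}"
      unfolding assms(3) using assms by (intro ennreal_mult) auto
    finally show ?thesis by (metis mult.assoc mult.commute)
  qed
  let ?F = "\<lambda>n. of_nat n * f n * emeasure D {n}"
  have "(\<lambda>n. ?F (Suc n)) sums (\<Sum>n. ?F (Suc n))" by (intro summable_sums summableI)
  then have "?F sums ((\<Sum>n. ?F (Suc n)) + ?F 0)" by (rule sums_Suc)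
  then have "(\<Sum>n. ?F n) = (\<Sum>n. ?F (Suc n))" by (simp add: sums_iff)
  also have "\<dots> = ennreal a * (\<Sum>n. f (Suc n) * emeasure D {n})"
    unfolding eq by (rule ennreal_suminf_cmult)
  finally show ?thesis by (simp add: nn_integral_nat_measure[OF assms(1)])
qed

section \<open>The law of the active transmitters\<close>

locale positive_CA_network = CA_network +
  assumes lam_pos: "lam > 0" and r_pos: "r_gz > 0"
begin

text \<open>A square has an active transmitter exactly if it is nonempty; this is the probability of
  that event divided by the area of the square. That it is the intensity of \<open>\<Psi>\<close> is
  shown in \<open>has_intensity_Psi\<close>.\<close>

definition active_intensity :: real where
  "active_intensity = (1 - exp (- (lam * (4 * r_gz\<^sup>2)))) / (4 * r_gz\<^sup>2)"

lemma active_intensity_nonneg: "active_intensity \<ge> 0"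
  using lam_pos by (simp add: active_intensity_def)

lemma Phi_measurable [measurable]: "\<Phi> \<in> M \<rightarrow>\<^sub>M config_space"
  using transmitters by (simp add: poisson_process_def)

lemma Psi_measurable [measurable]: "\<Psi> \<in> M \<rightarrow>\<^sub>M config_space"
  using active by (simp add: uniform_selection_def)

lemma count_measurable:
  assumes "B \<in> sets borel" "bounded B"
  shows "(\<lambda>\<omega>. card (\<Phi> \<omega> \<inter> B)) \<in> M \<rightarrow>\<^sub>M count_space UNIV"
    and "(\<lambda>\<omega>. card (\<Psi> \<omega> \<inter> B)) \<in> M \<rightarrow>\<^sub>M count_space UNIV"
  using measurable_compose[OF Phi_measurable measurable_card_Int]
    measurable_compose[OF Psi_measurable measurable_card_Int] assms by auto

lemma finite_Phi_Int: "\<omega> \<in> space M \<Longrightarrow> bounded B \<Longrightarrow> finite (\<Phi> \<omega> \<inter> B)"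
  using measurable_space[OF Phi_measurable] by (rule finite_configuration_Int)

lemma finite_Psi_Int: "\<omega> \<in> space M \<Longrightarrow> bounded B \<Longrightarrow> finite (\<Psi> \<omega> \<inter> B)"
  using measurable_space[OF Psi_measurable] by (rule finite_configuration_Int)

lemma card_Phi_split:
  assumes "\<omega> \<in> space M" "bounded S" "B \<subseteq> S"
  shows "card (\<Phi> \<omega> \<inter> S) = card (\<Phi> \<omega> \<inter> B) + card (\<Phi> \<omega> \<inter> (S - B))"
proof -
  have "bounded B" "bounded (S - B)" using assms by (auto intro: bounded_subset)
  then have "card ((\<Phi> \<omega> \<inter> B) \<union> (\<Phi> \<omega> \<inter> (S - B))) = card (\<Phi> \<omega> \<inter> B) + card (\<Phi> \<omega> \<inter> (S - B))"
    using assms finite_Phi_Int by (intro card_Un_disjoint) auto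
  moreover have "(\<Phi> \<omega> \<inter> B) \<union> (\<Phi> \<omega> \<inter> (S - B)) = \<Phi> \<omega> \<inter> S" using assms by auto
  ultimately show ?thesis by simp
qed

lemma emeasure_count:
  assumes "B \<in> sets borel" "bounded B"
  shows "emeasure (distr M (count_space UNIV) (\<lambda>\<omega>. card (\<Phi> \<omega> \<inter> B))) {n} =
    ennreal ((lam * measure lborel B) ^ n / fact n * exp (- (lam * measure lborel B)))"
proof -
  have "emeasure (distr M (count_space UNIV) (\<lambda>\<omega>. card (\<Phi> \<omega> \<inter> B))) {n} =
      emeasure M {\<omega> \<in> space M. card (\<Phi> \<omega> \<inter> B) = n}"
    using assms by (subst emeasure_distr) (auto intro!: count_measurable arg_cong[where f = "emeasure M"])
  also have "\<dots> = ennreal ((lam * measure lborel B) ^ n / fact n * exp (- (lam * measure lborel B)))"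
    using transmitters assms by (simp add: emeasure_eq_measure poisson_process_def)
  finally show ?thesis .
qed

lemma indep_counts:
  fixes B :: "nat \<Rightarrow> plane set"
  assumes "disjoint_family B" "\<And>i. B i \<in> sets borel" "\<And>i. bounded (B i)"
  shows "indep_vars (\<lambda>_. count_space UNIV) (\<lambda>i \<omega>. card (\<Phi> \<omega> \<inter> B i)) UNIV"
  using transmitters assms by (simp add: poisson_process_def)

lemma indep_counts2:
  assumes "B \<inter> C = {}" "B \<in> sets borel" "bounded B" "C \<in> sets borel" "bounded C"
  shows "indep_var (count_space UNIV) (\<lambda>\<omega>. card (\<Phi> \<omega> \<inter> B)) (count_space UNIV) (\<lambda>\<omega>. card (\<Phi> \<omega> \<inter> C))"
proof -
  \<comment> \<open>The independence axiom of the process concerns sequences of sets, so the pair is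
    padded with empty sets.\<close>
  define D :: "nat \<Rightarrow> plane set" where "D i = (if i = 0 then B else if i = 1 then C else {})" for i
  have ind: "indep_vars (\<lambda>_. count_space UNIV) (\<lambda>i \<omega>. card (\<Phi> \<omega> \<inter> D i)) UNIV"
    by (rule indep_counts) (use assms in \<open>auto simp: D_def disjoint_family_on_def\<close>)
  have "indep_var
      (count_space UNIV) ((\<lambda>f. f 0) \<circ> (\<lambda>\<omega>. restrict (\<lambda>i. card (\<Phi> \<omega> \<inter> D i)) {0}))
      (count_space UNIV) ((\<lambda>f. f 1) \<circ> (\<lambda>\<omega>. restrict (\<lambda>i. card (\<Phi> \<omega> \<inter> D i)) {1}))"
    by (rule indep_var_compose[OF indep_var_restrict[OF ind]]) (auto intro: measurable_component_singleton)
  then show ?thesis by (simp add: comp_def D_def)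
qed

text \<open>Given \<open>\<Phi>\<close>, the ratio is the chance that the active transmitter of the
  square lies in \<open>B\<close>. Mecke's identity is used twice: for the count in
  \<open>B\<close>, with the independent count in the rest of the square held fixed, it yields
  \<open>lam * |B|\<close> times the mean of \<open>1 / (N + 1)\<close>, where \<open>N\<close> is
  the count of the square; for \<open>N\<close> itself it evaluates that mean.\<close>

lemma nn_integral_count_ratio:
  assumes "B \<subseteq> square r_gz k" "B \<in> sets borel"
  shows "(\<integral>\<^sup>+\<omega>. ennreal (real (card (\<Phi> \<omega> \<inter> B)) / real (card (\<Phi> \<omega> \<inter> square r_gz k))) \<partial>M) =
    ennreal (active_intensity * measure lborel B)"
proof -
  let ?S = "square r_gz k"
  let ?C = "?S - B"
  let ?N = "\<lambda>B \<omega>. card (\<Phi> \<omega> \<inter> B)"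
  let ?D = "\<lambda>B. distr M (count_space UNIV) (?N B)"
  let ?c = "lam * (4 * r_gz\<^sup>2)"
  have bB: "bounded B" and bC: "bounded ?C" and C: "?C \<in> sets borel"
    using assms bounded_subset[OF bounded_square, of _ r_gz k] by auto
  have [measurable]: "?N B \<in> M \<rightarrow>\<^sub>M count_space UNIV" "?N ?C \<in> M \<rightarrow>\<^sub>M count_space UNIV" "?N ?S \<in> M \<rightarrow>\<^sub>M count_space UNIV"
    using assms bB bC C bounded_square[of r_gz k] by (auto intro!: count_measurable)
  have ind: "indep_var (count_space UNIV) (?N B) (count_space UNIV) (?N ?C)"
    using assms bB bC C by (intro indep_counts2) auto
  interpret X: prob_space "?D B" by (rule prob_space_distr) simp
  interpret Y: prob_space "?D ?C" by (rule prob_space_distr) simp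
  interpret XY: pair_prob_space "?D B" "?D ?C" ..
  \<comment> \<open>By independence the joint law is a product. The count in \<open>B\<close> goes
    into the inner integral, where Mecke's identity will act on it.\<close>
  have joint: "(\<integral>\<^sup>+\<omega>. f (?N B \<omega>) (?N ?C \<omega>) \<partial>M) = (\<integral>\<^sup>+y. \<integral>\<^sup>+x. f x y \<partial>?D B \<partial>?D ?C)"
    for f :: "nat \<Rightarrow> nat \<Rightarrow> ennreal"
  proof -
    have f: "(\<lambda>(x, y). f x y) \<in> borel_measurable (count_space UNIV \<Otimes>\<^sub>M count_space UNIV)"
      by (simp add: pair_measure_countable)
    have "(\<integral>\<^sup>+\<omega>. f (?N B \<omega>) (?N ?C \<omega>) \<partial>M) =
        (\<integral>\<^sup>+z. (\<lambda>(x, y). f x y) z \<partial>distr M (count_space UNIV \<Otimes>\<^sub>M count_space UNIV) (\<lambda>\<omega>. (?N B \<omega>, ?N ?C \<omega>)))"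
      using f by (subst nn_integral_distr) auto
    also have "\<dots> = (\<integral>\<^sup>+z. (\<lambda>(x, y). f x y) z \<partial>(?D B \<Otimes>\<^sub>M ?D ?C))"
      using ind by (simp add: indep_var_distribution_eq)
    also have "\<dots> = (\<integral>\<^sup>+y. \<integral>\<^sup>+x. f x y \<partial>?D B \<partial>?D ?C)"
    proof -
      have "sets (?D B \<Otimes>\<^sub>M ?D ?C) = sets (count_space UNIV \<Otimes>\<^sub>M count_space UNIV)"
        by (intro sets_pair_measure_cong) simp_all
      then have "(\<lambda>(x, y). f x y) \<in> borel_measurable (?D B \<Otimes>\<^sub>M ?D ?C)"
        using f by (subst measurable_cong_sets[OF _ refl])
      from XY.nn_integral_snd[OF this] show ?thesis by (simp only: prod.case)
    qed
    finally show ?thesis .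
  qed
  have "(\<integral>\<^sup>+\<omega>. ennreal (real (?N B \<omega>) / real (?N ?S \<omega>)) \<partial>M) =
      (\<integral>\<^sup>+\<omega>. of_nat (?N B \<omega>) * ennreal (1 / real (?N B \<omega> + ?N ?C \<omega>)) \<partial>M)"
  proof (rule nn_integral_cong)
    fix \<omega> assume "\<omega> \<in> space M"
    then have "?N ?S \<omega> = ?N B \<omega> + ?N ?C \<omega>"
      using assms by (intro card_Phi_split bounded_square)
    \<comment> \<open>For an empty square both sides are 0, by \<open>0 / 0 = 0\<close> on the left
      and by the factor 0 on the right.\<close>
    then show "ennreal (real (?N B \<omega>) / real (?N ?S \<omega>)) =
        of_nat (?N B \<omega>) * ennreal (1 / real (?N B \<omega> + ?N ?C \<omega>))"
      by (simp add: ennreal_of_nat_eq_real_of_nat ennreal_mult''[symmetric])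
  qed
  also have "\<dots> = (\<integral>\<^sup>+y. \<integral>\<^sup>+x. of_nat x * ennreal (1 / real (x + y)) \<partial>?D B \<partial>?D ?C)"
    by (rule joint)
  also have "\<dots> = (\<integral>\<^sup>+y. ennreal (lam * measure lborel B) * (\<integral>\<^sup>+x. ennreal (1 / real (Suc x + y)) \<partial>?D B) \<partial>?D ?C)"
    using assms bB lam_pos
    by (intro nn_integral_cong mecke_poisson emeasure_count) auto
  also have "\<dots> = ennreal (lam * measure lborel B) * (\<integral>\<^sup>+y. \<integral>\<^sup>+x. ennreal (1 / real (Suc x + y)) \<partial>?D B \<partial>?D ?C)"
    by (rule nn_integral_cmult) (simp add: measurable_def)
  also have "(\<integral>\<^sup>+y. \<integral>\<^sup>+x. ennreal (1 / real (Suc x + y)) \<partial>?D B \<partial>?D ?C) =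
      (\<integral>\<^sup>+\<omega>. ennreal (1 / real (Suc (?N B \<omega>) + ?N ?C \<omega>)) \<partial>M)"
    by (rule joint[symmetric])
  also have "\<dots> = (\<integral>\<^sup>+\<omega>. ennreal (1 / real (Suc (?N ?S \<omega>))) \<partial>M)"
  proof (rule nn_integral_cong)
    fix \<omega> assume "\<omega> \<in> space M"
    then have "?N ?S \<omega> = ?N B \<omega> + ?N ?C \<omega>"
      using assms by (intro card_Phi_split bounded_square)
    then show "ennreal (1 / real (Suc (?N B \<omega>) + ?N ?C \<omega>)) = ennreal (1 / real (Suc (?N ?S \<omega>)))"
      by simp
  qed
  also have "\<dots> = (\<integral>\<^sup>+n. ennreal (1 / real (Suc n)) \<partial>?D ?S)"
    by (subst nn_integral_distr) auto
  also have "\<dots> = ennreal ((1 - exp (- ?c)) / ?c)"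
  proof -
    interpret S: prob_space "?D ?S" by (rule prob_space_distr) simp
    have c: "?c > 0" using lam_pos r_pos by simp
    have vol: "measure lborel ?S = 4 * r_gz\<^sup>2"
      using emeasure_square[OF r_pos] by (simp add: measure_def)
    have atom: "emeasure (?D ?S) {n} = ennreal (?c ^ n / fact n * exp (- ?c))" for n
      using emeasure_count[of ?S n] bounded_square[of r_gz k] by (simp add: vol)
    \<comment> \<open>Mecke's identity backwards: for \<open>f n = 1 / n\<close> the product
      \<open>n * f n\<close> is the indicator of \<open>n \<noteq> 0\<close>, so its mean is the
      probability of a nonempty square.\<close>
    have "ennreal ?c * (\<integral>\<^sup>+n. ennreal (1 / real (Suc n)) \<partial>?D ?S) =
        (\<integral>\<^sup>+n. of_nat n * ennreal (1 / real n) \<partial>?D ?S)"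
      by (subst mecke_poisson[OF _ _ atom]) (use c in auto)
    also have "\<dots> = (\<integral>\<^sup>+n. indicator (- {0}) n \<partial>?D ?S)"
      by (intro nn_integral_cong)
         (auto simp: indicator_def ennreal_of_nat_eq_real_of_nat ennreal_mult[symmetric])
    also have "\<dots> = emeasure (?D ?S) (space (?D ?S) - {0})"
      by (simp add: Compl_eq_Diff_UNIV)
    also have "\<dots> = 1 - ennreal (exp (- ?c))"
      by (subst emeasure_compl) (use S.emeasure_space_1 atom[of 0] in auto)
    also have "\<dots> = ennreal (1 - exp (- ?c))"
      by (subst ennreal_minus[symmetric]) auto
    finally have "ennreal ?c * (\<integral>\<^sup>+n. ennreal (1 / real (Suc n)) \<partial>?D ?S) = ennreal (1 - exp (- ?c))" .
    moreover have "(\<integral>\<^sup>+n. ennreal (1 / real (Suc n)) \<partial>?D ?S) =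
        ennreal (1 / ?c) * (ennreal ?c * (\<integral>\<^sup>+n. ennreal (1 / real (Suc n)) \<partial>?D ?S))"
    proof -
      have "ennreal (1 / ?c) * ennreal ?c = 1"
        using c by (subst ennreal_mult[symmetric]) auto
      then show ?thesis by (simp only: mult.assoc[symmetric] mult_1)
    qed
    ultimately show ?thesis using c by (simp add: ennreal_mult[symmetric])
  qed
  also have "ennreal (lam * measure lborel B) * ennreal ((1 - exp (- ?c)) / ?c) =
      ennreal (active_intensity * measure lborel B)"
    using lam_pos by (subst ennreal_mult[symmetric]) (auto simp: active_intensity_def)
  finally show ?thesis .
qed

text \<open>The conditional probability is averaged over \<open>\<Phi>\<close>. The ratio of a
  square depends only on the counts in \<open>B k\<close> and in the rest of that square; all these
  sets are disjoint, so the ratios are independent and the mean of their product factors.\<close>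

lemma prob_active:
  assumes fin: "finite K" and B: "\<And>k. k \<in> K \<Longrightarrow> B k \<in> sets borel" "\<And>k. k \<in> K \<Longrightarrow> B k \<subseteq> square r_gz k"
  shows "prob {\<omega> \<in> space M. \<forall>k\<in>K. \<Psi> \<omega> \<inter> B k \<noteq> {}} = (\<Prod>k\<in>K. active_intensity * measure lborel (B k))"
proof -
  define B' where "B' k = (if k \<in> K then B k else {})" for k
  have B': "B' k \<in> sets borel" "B' k \<subseteq> square r_gz k" for k
    using B by (auto simp: B'_def)
  define e :: "nat \<Rightarrow> int \<times> int" where "e = from_nat_into UNIV"
  have e: "bij e"
    unfolding e_def by (rule bij_betw_from_nat_into) (auto simp: finite_prod)
  \<comment> \<open>With the squares enumerated by \<open>e\<close>, even indices carry
    \<open>B' k\<close> and odd ones the rest of square \<open>k\<close>, where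
    \<open>k = e (m div 2)\<close>: one sequence of disjoint sets, as the process axiom
    wants.\<close>
  define D where "D m = (if even m then B' (e (m div 2)) else square r_gz (e (m div 2)) - B' (e (m div 2)))" for m
  have D_sub: "D m \<subseteq> square r_gz (e (m div 2))" for m
    using B' by (auto simp: D_def)
  have disj: "disjoint_family D"
    unfolding disjoint_family_on_def
  proof (intro ballI impI)
    fix m n :: nat assume "m \<noteq> n"
    show "D m \<inter> D n = {}"
    proof (cases "m div 2 = n div 2")
      case True
      with \<open>m \<noteq> n\<close> have "even m \<noteq> even n" by (metis dvd_div_mult_self odd_two_times_div_two_succ mult.commute)
      then show ?thesis using True by (auto simp: D_def)
    next
      case False
      then have "e (m div 2) \<noteq> e (n div 2)" using e by (auto simp: bij_def inj_def)
      then show ?thesis using D_sub[of m] D_sub[of n] disjoint_squares[OF r_pos] by blast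
    qed
  qed
  have D_borel: "D m \<in> sets borel" for m using B' by (auto simp: D_def)
  have D_bdd: "bounded (D m)" for m using D_sub bounded_subset[OF bounded_square] by blast
  have ind: "indep_vars (\<lambda>_. count_space UNIV) (\<lambda>i \<omega>. card (\<Phi> \<omega> \<inter> D i)) UNIV"
    by (rule indep_counts[OF disj D_borel D_bdd])
  \<comment> \<open>The denominator is a sum of two counts, so that \<open>R (e j)\<close> is a
    function of the block of indices \<open>2 * j\<close> and \<open>Suc (2 * j)\<close>.\<close>
  define R where "R k \<omega> = ennreal (real (card (\<Phi> \<omega> \<inter> B' k)) /
    real (card (\<Phi> \<omega> \<inter> B' k) + card (\<Phi> \<omega> \<inter> (square r_gz k - B' k))))" for k \<omega>
  have R_eq: "R k \<omega> = ennreal (real (card (\<Phi> \<omega> \<inter> B' k)) / real (card (\<Phi> \<omega> \<inter> square r_gz k)))"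
    if "\<omega> \<in> space M" for k \<omega>
    using card_Phi_split[OF that bounded_square B'(2)] by (simp add: R_def)
  let ?I = "\<lambda>j :: nat. {2 * j, Suc (2 * j)}"
  let ?q = "\<lambda>j f. ennreal (real (f (2 * j)) / real (f (2 * j) + f (Suc (2 * j)) :: nat))"
  have "indep_vars (\<lambda>j. \<Pi>\<^sub>M i\<in>?I j. count_space UNIV) (\<lambda>j \<omega>. \<lambda>i\<in>?I j. card (\<Phi> \<omega> \<inter> D i)) UNIV"
  proof (rule indep_vars_restrict[OF ind])
    show "disjoint_family_on ?I UNIV"
    proof (unfold disjoint_family_on_def, intro ballI impI)
      fix m n :: nat assume "m \<noteq> n"
      moreover have "2 * m \<noteq> Suc (2 * n)" "2 * n \<noteq> Suc (2 * m)" by presburger+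
      ultimately show "?I m \<inter> ?I n = {}" by auto
    qed
  qed simp
  then have "indep_vars (\<lambda>_. borel) (\<lambda>j \<omega>. ?q j (\<lambda>i\<in>?I j. card (\<Phi> \<omega> \<inter> D i))) UNIV"
  proof (rule indep_vars_compose2)
    fix j :: nat
    have [measurable]: "(\<lambda>f. f (2 * j)) \<in> (\<Pi>\<^sub>M i\<in>?I j. count_space UNIV) \<rightarrow>\<^sub>M (count_space UNIV :: nat measure)"
      "(\<lambda>f. f (Suc (2 * j))) \<in> (\<Pi>\<^sub>M i\<in>?I j. count_space UNIV) \<rightarrow>\<^sub>M (count_space UNIV :: nat measure)"
      by (auto intro: measurable_component_singleton)
    show "?q j \<in> borel_measurable (\<Pi>\<^sub>M i\<in>?I j. count_space UNIV)"
      by measurable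
  qed
  moreover have "(\<lambda>j \<omega>. ?q j (\<lambda>i\<in>?I j. card (\<Phi> \<omega> \<inter> D i))) = (\<lambda>j. R (e j))"
    by (intro ext) (simp add: R_def D_def)
  ultimately have indR: "indep_vars (\<lambda>_. borel) (\<lambda>j. R (e j)) UNIV"
    by simp
  have bij: "bij_betw e (e -` K) K"
    using e inj_on_subset[of e UNIV "e -` K"] unfolding bij_betw_def
    by (simp add: surj_image_vimage_eq)
  have fin': "finite (e -` K)" using bij fin by (simp add: bij_betw_finite)
  have "(\<integral>\<^sup>+\<omega>. (\<Prod>k\<in>K. R k \<omega>) \<partial>M) = (\<integral>\<^sup>+\<omega>. (\<Prod>j\<in>e -` K. R (e j) \<omega>) \<partial>M)"
    by (intro nn_integral_cong prod.reindex_bij_betw[OF bij, symmetric])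
  also have "\<dots> = (\<Prod>j\<in>e -` K. \<integral>\<^sup>+\<omega>. R (e j) \<omega> \<partial>M)"
    by (intro indep_vars_nn_integral fin' indep_vars_subset[OF indR]) auto
  also have "\<dots> = (\<Prod>k\<in>K. \<integral>\<^sup>+\<omega>. R k \<omega> \<partial>M)"
    by (rule prod.reindex_bij_betw[OF bij])
  also have "\<dots> = (\<Prod>k\<in>K. ennreal (active_intensity * measure lborel (B' k)))"
  proof (intro prod.cong refl)
    fix k assume "k \<in> K"
    have "(\<integral>\<^sup>+\<omega>. R k \<omega> \<partial>M) =
        (\<integral>\<^sup>+\<omega>. ennreal (real (card (\<Phi> \<omega> \<inter> B' k)) / real (card (\<Phi> \<omega> \<inter> square r_gz k))) \<partial>M)"
      by (intro nn_integral_cong R_eq)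
    also have "\<dots> = ennreal (active_intensity * measure lborel (B' k))"
      using B' by (intro nn_integral_count_ratio)
    finally show "(\<integral>\<^sup>+\<omega>. R k \<omega> \<partial>M) = ennreal (active_intensity * measure lborel (B' k))" .
  qed
  also have "\<dots> = ennreal (\<Prod>k\<in>K. active_intensity * measure lborel (B' k))"
    using active_intensity_nonneg by (intro prod_ennreal) auto
  finally have nn: "(\<integral>\<^sup>+\<omega>. (\<Prod>k\<in>K. R k \<omega>) \<partial>M) = ennreal (\<Prod>k\<in>K. active_intensity * measure lborel (B' k))" .
  let ?f = "\<lambda>\<omega>. \<Prod>k\<in>K. real (card (\<Phi> \<omega> \<inter> B k)) / real (card (\<Phi> \<omega> \<inter> square r_gz k))"
  have [measurable]: "?f \<in> borel_measurable M"
  proof (rule borel_measurable_prod)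
    fix k assume k: "k \<in> K"
    have [measurable]: "(\<lambda>\<omega>. card (\<Phi> \<omega> \<inter> B k)) \<in> M \<rightarrow>\<^sub>M count_space UNIV"
      "(\<lambda>\<omega>. card (\<Phi> \<omega> \<inter> square r_gz k)) \<in> M \<rightarrow>\<^sub>M count_space UNIV"
      using count_measurable(1)[OF B(1)[OF k] bounded_subset[OF bounded_square B(2)[OF k]]]
        count_measurable(1)[OF sets_square bounded_square, of r_gz k] by simp_all
    show "(\<lambda>\<omega>. real (card (\<Phi> \<omega> \<inter> B k)) / real (card (\<Phi> \<omega> \<inter> square r_gz k))) \<in> borel_measurable M"
      by measurable
  qed
  have conf: "configurations \<in> sets config_space"
    using sets.top[of config_space] by (simp add: space_config_space)
  have in_conf: "\<Phi> \<omega> \<in> configurations" if "\<omega> \<in> space M" for \<omega>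
    using measurable_space[OF Phi_measurable that] by (simp add: space_config_space)
  \<comment> \<open>Taking the set of all configurations for \<open>A\<close> in
    \<open>uniform_selection\<close> removes the condition on \<open>\<Phi>\<close>.\<close>
  have "prob {\<omega> \<in> space M. \<Phi> \<omega> \<in> configurations \<and> (\<forall>k\<in>K. \<Psi> \<omega> \<inter> B k \<noteq> {})} =
      (\<integral>\<omega>. indicator configurations (\<Phi> \<omega>) * ?f \<omega> \<partial>M)"
  proof -
    have "finite K \<and> (\<forall>k\<in>K. B k \<in> sets borel \<and> B k \<subseteq> square r_gz k)" using fin B by simp
    then show ?thesis
      using active[unfolded uniform_selection_def, THEN conjunct2, THEN conjunct2, rule_format, OF conf] by simp
  qed
  also have "\<dots> = (\<integral>\<omega>. ?f \<omega> \<partial>M)"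
    using in_conf by (intro Bochner_Integration.integral_cong) auto
  also have "\<dots> = enn2real (\<integral>\<^sup>+\<omega>. ennreal (?f \<omega>) \<partial>M)"
    by (intro integral_eq_nn_integral AE_I2 prod_nonneg) auto
  also have "(\<integral>\<^sup>+\<omega>. ennreal (?f \<omega>) \<partial>M) = (\<integral>\<^sup>+\<omega>. (\<Prod>k\<in>K. R k \<omega>) \<partial>M)"
    by (intro nn_integral_cong) (simp add: R_eq B'_def prod_ennreal[symmetric])
  also have "enn2real \<dots> = (\<Prod>k\<in>K. active_intensity * measure lborel (B' k))"
    unfolding nn using active_intensity_nonneg by (intro enn2real_ennreal prod_nonneg) auto
  also have "\<dots> = (\<Prod>k\<in>K. active_intensity * measure lborel (B k))"
    by (simp add: B'_def)
  finally show ?thesis using in_conf by (simp cong: conj_cong)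
qed

text \<open>The events in terms of which \<open>uniform_selection\<close> describes the active
  transmitters; further statements about \<open>\<Psi>\<close> are reduced to them.\<close>

definition hit :: "plane set \<Rightarrow> 'a set" where
  "hit B = {\<omega> \<in> space M. \<Psi> \<omega> \<inter> B \<noteq> {}}"

lemma hit_events:
  assumes "B \<in> sets borel" "bounded B"
  shows "hit B \<in> events"
proof -
  have "hit B = (\<lambda>\<omega>. card (\<Psi> \<omega> \<inter> B)) -` (- {0}) \<inter> space M"
    using finite_Psi_Int[OF _ assms(2)] by (auto simp: hit_def)
  also have "\<dots> \<in> events" by (rule measurable_sets[OF count_measurable(2)[OF assms]]) simp
  finally show ?thesis .
qed

lemma hit_square_events:
  assumes "B \<in> sets borel" "B \<subseteq> square r_gz k"
  shows "hit B \<in> events"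
  using hit_events[OF assms(1)] bounded_subset[OF bounded_square assms(2)] by blast

lemma Psi_square_cases:
  assumes "\<omega> \<in> space M"
  obtains "\<Psi> \<omega> \<inter> square r_gz k = {}" | x where "\<Psi> \<omega> \<inter> square r_gz k = {x}"
proof -
  have "card (\<Psi> \<omega> \<inter> square r_gz k) = (if \<Phi> \<omega> \<inter> square r_gz k = {} then 0 else 1)"
    using active assms unfolding uniform_selection_def by blast
  then have "card (\<Psi> \<omega> \<inter> square r_gz k) \<le> 1"
    by (simp split: if_splits)
  then have "card (\<Psi> \<omega> \<inter> square r_gz k) = 0 \<or> card (\<Psi> \<omega> \<inter> square r_gz k) = 1" by linarith
  then show thesis
    using finite_Psi_Int[OF assms bounded_square, of r_gz k] that by (auto simp: card_1_singleton_iff)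
qed

text \<open>A square has at most one active transmitter, so the same point meets both sets. Hence
  the events \<open>hit B\<close> with \<open>B\<close> inside one square are closed under
  intersection, which is needed to extend independence to the sigma-algebra they generate.\<close>

lemma hit_Int:
  assumes "B \<subseteq> square r_gz k" "C \<subseteq> square r_gz k"
  shows "hit B \<inter> hit C = hit (B \<inter> C)"
proof -
  have "\<omega> \<in> hit B \<inter> hit C \<longleftrightarrow> \<omega> \<in> hit (B \<inter> C)" if "\<omega> \<in> space M" for \<omega>
  proof (cases rule: Psi_square_cases[OF that, of k])
    case 1
    then show ?thesis using assms by (auto simp: hit_def)
  next
    case (2 x)
    have "\<Psi> \<omega> \<inter> D \<noteq> {} \<longleftrightarrow> x \<in> D" if D: "D \<subseteq> square r_gz k" for D
    proof -
      have "\<Psi> \<omega> \<inter> D = \<Psi> \<omega> \<inter> square r_gz k \<inter> D" using D by blast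
      then show ?thesis unfolding 2 by auto
    qed
    moreover have "B \<inter> C \<subseteq> square r_gz k" using assms by blast
    ultimately show ?thesis using assms \<open>\<omega> \<in> space M\<close> by (simp add: hit_def)
  qed
  then show ?thesis by (auto simp: hit_def)
qed

lemma prob_hit:
  assumes "B \<in> sets borel" "B \<subseteq> square r_gz k"
  shows "prob (hit B) = active_intensity * measure lborel B"
  using prob_active[of "{k}" "\<lambda>_. B"] assms by (simp add: hit_def)

text \<open>The sum has at most one term: it is \<open>f\<close> at the active transmitter, or 0 for
  a square without one, whence the case distinction on \<open>0 \<in> A\<close>.\<close>

lemma active_sum_vimage:
  fixes f :: "plane \<Rightarrow> 'b :: comm_monoid_add"
  shows "(\<lambda>\<omega>. \<Sum>x\<in>\<Psi> \<omega> \<inter> square r_gz k. f x) -` A \<inter> space M =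
    hit (square r_gz k \<inter> f -` A) \<union> (if 0 \<in> A then space M - hit (square r_gz k) else {})"
proof -
  have "(\<Sum>x\<in>\<Psi> \<omega> \<inter> square r_gz k. f x) \<in> A \<longleftrightarrow>
      \<omega> \<in> hit (square r_gz k \<inter> f -` A) \<union> (if 0 \<in> A then space M - hit (square r_gz k) else {})"
    if \<omega>: "\<omega> \<in> space M" for \<omega>
  proof (cases rule: Psi_square_cases[OF \<omega>, of k])
    case 1
    then show ?thesis using \<omega> by (auto simp: hit_def)
  next
    case (2 x)
    then show ?thesis using \<omega> by (auto simp: hit_def)
  qed
  then show ?thesis by (auto simp: hit_def split: if_splits)
qed

text \<open>More than measurability is needed: knowing that the preimage is generated by hit events
  of the same square carries the independence of the squares over to such sums.\<close>

lemma active_sum_sigma: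
  fixes f :: "plane \<Rightarrow> 'b :: {comm_monoid_add, topological_space}"
  assumes f: "f \<in> borel_measurable borel" and A: "A \<in> sets borel"
  shows "(\<lambda>\<omega>. \<Sum>x\<in>\<Psi> \<omega> \<inter> square r_gz k. f x) -` A \<inter> space M \<in>
    sigma_sets (space M) {hit B | B. B \<in> sets borel \<and> B \<subseteq> square r_gz k}"
proof -
  have "f -` A \<in> sets borel" using measurable_sets[OF f A] by simp
  then have "hit (square r_gz k \<inter> f -` A) \<in> sigma_sets (space M) {hit B | B. B \<in> sets borel \<and> B \<subseteq> square r_gz k}"
    by (intro sigma_sets.Basic) auto
  moreover have "space M - hit (square r_gz k) \<in> sigma_sets (space M) {hit B | B. B \<in> sets borel \<and> B \<subseteq> square r_gz k}"
    by (intro sigma_sets.Compl sigma_sets.Basic) auto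
  ultimately show ?thesis
    unfolding active_sum_vimage by (auto intro: sigma_sets_Un)
qed

lemma active_sum_measurable:
  fixes f :: "plane \<Rightarrow> 'b :: {comm_monoid_add, topological_space}"
  assumes f: "f \<in> borel_measurable borel"
  shows "(\<lambda>\<omega>. \<Sum>x\<in>\<Psi> \<omega> \<inter> square r_gz k. f x) \<in> borel_measurable M"
proof (rule measurableI)
  have sub: "{hit B | B. B \<in> sets borel \<and> B \<subseteq> square r_gz k} \<subseteq> events"
    using hit_square_events[where k = k] by auto
  fix A :: "'b set" assume "A \<in> sets borel"
  from active_sum_sigma[OF f this]
  show "(\<lambda>\<omega>. \<Sum>x\<in>\<Psi> \<omega> \<inter> square r_gz k. f x) -` A \<inter> space M \<in> events"
    using sets.sigma_sets_subset[OF sub] by blast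
qed simp

text \<open>Campbell's formula for one square. For an indicator the sum is the indicator of a hit
  event, whose probability is linear in the area; linearity and monotone limits do the rest.\<close>

lemma campbell_square:
  fixes f :: "plane \<Rightarrow> ennreal"
  assumes "f \<in> borel_measurable borel"
  shows "(\<integral>\<^sup>+\<omega>. (\<Sum>x\<in>\<Psi> \<omega> \<inter> square r_gz k. f x) \<partial>M) =
    ennreal active_intensity * (\<integral>\<^sup>+x. f x * indicator (square r_gz k) x \<partial>lborel)"
  using assms
proof (induction rule: borel_measurable_induct)
  case (cong f g)
  then show ?case by simp
next
  case (set A)
  let ?S = "square r_gz k"
  have "(\<Sum>x\<in>\<Psi> \<omega> \<inter> ?S. indicator A x) = (indicator (hit (A \<inter> ?S)) \<omega> :: ennreal)" if "\<omega> \<in> space M" for \<omega>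
  proof (cases rule: Psi_square_cases[OF that, of k])
    case 1
    then have "\<omega> \<notin> hit (A \<inter> ?S)" by (auto simp: hit_def)
    then show ?thesis using 1 by simp
  next
    case (2 x)
    have "\<Psi> \<omega> \<inter> (A \<inter> ?S) = \<Psi> \<omega> \<inter> ?S \<inter> A" by blast
    then have "\<omega> \<in> hit (A \<inter> ?S) \<longleftrightarrow> x \<in> A" using that 2 by (simp add: hit_def)
    then show ?thesis using 2 by (simp add: indicator_def)
  qed
  then have "(\<integral>\<^sup>+\<omega>. (\<Sum>x\<in>\<Psi> \<omega> \<inter> ?S. indicator A x) \<partial>M) =
      (\<integral>\<^sup>+\<omega>. indicator (hit (A \<inter> ?S)) \<omega> \<partial>M)"
    by (rule nn_integral_cong)
  also have "\<dots> = emeasure M (hit (A \<inter> ?S))"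
    using set by (intro nn_integral_indicator hit_square_events) auto
  also have "\<dots> = ennreal active_intensity * ennreal (measure lborel (A \<inter> ?S))"
    using set prob_hit[of "A \<inter> ?S" k] active_intensity_nonneg by (simp add: emeasure_eq_measure ennreal_mult)
  also have "ennreal (measure lborel (A \<inter> ?S)) = emeasure lborel (A \<inter> ?S)"
    using emeasure_mono[of "A \<inter> ?S" ?S lborel] emeasure_square[OF r_pos, of k]
    by (intro emeasure_eq_ennreal_measure[symmetric]) (auto simp: top_unique)
  also have "\<dots> = (\<integral>\<^sup>+x. indicator A x * indicator ?S x \<partial>lborel)"
    using set by (simp add: indicator_inter_arith[symmetric])
  finally show ?case .
next
  case (mult u c)
  have "(\<integral>\<^sup>+\<omega>. (\<Sum>x\<in>\<Psi> \<omega> \<inter> square r_gz k. c * u x) \<partial>M) =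
      c * (\<integral>\<^sup>+\<omega>. (\<Sum>x\<in>\<Psi> \<omega> \<inter> square r_gz k. u x) \<partial>M)"
    unfolding sum_distrib_left[symmetric] by (intro nn_integral_cmult active_sum_measurable mult)
  moreover have "(\<integral>\<^sup>+x. c * u x * indicator (square r_gz k) x \<partial>lborel) =
      c * (\<integral>\<^sup>+x. u x * indicator (square r_gz k) x \<partial>lborel)"
    using mult by (subst nn_integral_cmult[symmetric]) (auto simp: mult.assoc)
  ultimately show ?case using mult.IH by (simp add: mult_ac)
next
  case (add u v)
  have "(\<integral>\<^sup>+\<omega>. (\<Sum>x\<in>\<Psi> \<omega> \<inter> square r_gz k. v x + u x) \<partial>M) =
      (\<integral>\<^sup>+\<omega>. (\<Sum>x\<in>\<Psi> \<omega> \<inter> square r_gz k. v x) \<partial>M) + (\<integral>\<^sup>+\<omega>. (\<Sum>x\<in>\<Psi> \<omega> \<inter> square r_gz k. u x) \<partial>M)"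
    unfolding sum.distrib by (intro nn_integral_add active_sum_measurable add)
  moreover have "(\<integral>\<^sup>+x. (v x + u x) * indicator (square r_gz k) x \<partial>lborel) =
      (\<integral>\<^sup>+x. v x * indicator (square r_gz k) x \<partial>lborel) + (\<integral>\<^sup>+x. u x * indicator (square r_gz k) x \<partial>lborel)"
    using add unfolding distrib_right by (intro nn_integral_add) auto
  ultimately show ?case using add.IH by (simp add: distrib_left)
next
  case (seq U)
  have [measurable]: "U i \<in> borel_measurable borel" for i by (rule seq)
  have incU: "incseq (\<lambda>i. U i x)" for x
    by (intro monoI le_funD[OF monoD[OF seq(3)]])
  have "(\<integral>\<^sup>+\<omega>. (\<Sum>x\<in>\<Psi> \<omega> \<inter> square r_gz k. (SUP i. U i) x) \<partial>M) =
      (\<integral>\<^sup>+\<omega>. (SUP i. \<Sum>x\<in>\<Psi> \<omega> \<inter> square r_gz k. U i x) \<partial>M)"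
    by (simp add: SUP_apply image_comp ennreal_SUP_sum[OF incU])
  also have "\<dots> = (SUP i. \<integral>\<^sup>+\<omega>. (\<Sum>x\<in>\<Psi> \<omega> \<inter> square r_gz k. U i x) \<partial>M)"
    by (intro nn_integral_monotone_convergence_SUP active_sum_measurable seq
        monoI le_funI sum_mono monoD[OF incU])
  also have "\<dots> = (SUP i. ennreal active_intensity * (\<integral>\<^sup>+x. U i x * indicator (square r_gz k) x \<partial>lborel))"
    by (simp add: seq.IH)
  also have "\<dots> = ennreal active_intensity * (SUP i. (\<integral>\<^sup>+x. U i x * indicator (square r_gz k) x \<partial>lborel))"
    by (rule SUP_mult_left_ennreal[symmetric])
  also have "(SUP i. (\<integral>\<^sup>+x. U i x * indicator (square r_gz k) x \<partial>lborel)) =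
      (\<integral>\<^sup>+x. (SUP i. U i x * indicator (square r_gz k) x) \<partial>lborel)"
    by (intro nn_integral_monotone_convergence_SUP[symmetric] monoI le_funI
        mult_right_mono monoD[OF incU]) auto
  also have "\<dots> = (\<integral>\<^sup>+x. (SUP i. U i) x * indicator (square r_gz k) x \<partial>lborel)"
    by (simp add: SUP_apply image_comp SUP_mult_right_ennreal)
  finally show ?case .
qed

end

section \<open>Intensity and interference\<close>

text \<open>Growing finite blocks that exhaust the lattice; they turn limits over all squares into
  countable monotone limits.\<close>

definition grid :: "nat \<Rightarrow> (int \<times> int) set" where
  "grid n = {- int n..int n} \<times> {- int n..int n}"

lemma finite_grid: "finite (grid n)"
  by (simp add: grid_def)

lemma mono_grid: "m \<le> n \<Longrightarrow> grid m \<subseteq> grid n"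
  by (auto simp: grid_def)

lemma mem_grid: "k \<in> grid (nat (max \<bar>fst k\<bar> \<bar>snd k\<bar>))"
  by (cases k) (auto simp: grid_def)

lemma finite_subset_grid:
  assumes "finite K"
  obtains n where "K \<subseteq> grid n"
proof -
  have "\<exists>n. K \<subseteq> grid n"
    using assms
  proof induction
    case (insert k K)
    then obtain n where n: "K \<subseteq> grid n" by blast
    let ?m = "max n (nat (max \<bar>fst k\<bar> \<bar>snd k\<bar>))"
    have "k \<in> grid ?m" using mem_grid[of k] mono_grid[of _ ?m] by (meson max.cobounded2 subsetD)
    moreover have "K \<subseteq> grid ?m" using n mono_grid[of n ?m] by simp
    ultimately show ?case by blast
  qed simp
  then show thesis using that by blast
qed

lemma bounded_subset_squares:
  assumes "r > 0" "bounded B"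
  obtains n where "B \<subseteq> (\<Union>k\<in>grid n. square r k)"
proof -
  obtain b where b: "\<And>x. x \<in> B \<Longrightarrow> norm x \<le> b"
    using assms(2) by (auto simp: bounded_iff)
  define n where "n = nat (\<lceil>(b + r) / (2 * r)\<rceil> + 1)"
  have fl: "\<lfloor>(y + r) / (2 * r)\<rfloor> \<in> {- int n..int n}" if "\<bar>y\<bar> \<le> b" for y
  proof -
    have le: "(y + r) / (2 * r) \<le> (b + r) / (2 * r)"
      using that assms(1) by (intro divide_right_mono) auto
    have ge: "- ((b + r) / (2 * r)) \<le> (y + r) / (2 * r)"
    proof -
      have "- ((b + r) / (2 * r)) = (- b - r) / (2 * r)" by (simp add: minus_divide_left)
      also have "\<dots> \<le> (y + r) / (2 * r)"
        using that assms(1) by (intro divide_right_mono) auto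
      finally show ?thesis .
    qed
    have "(b + r) / (2 * r) \<ge> 0"
      using that assms(1) by (intro divide_nonneg_nonneg) auto
    then have n: "int n = \<lceil>(b + r) / (2 * r)\<rceil> + 1" unfolding n_def by simp
    have "\<lfloor>(y + r) / (2 * r)\<rfloor> \<le> int n" using le unfolding n by linarith
    moreover have "- int n \<le> \<lfloor>(y + r) / (2 * r)\<rfloor>" using ge unfolding n by linarith
    ultimately show ?thesis by simp
  qed
  have "x \<in> (\<Union>k\<in>grid n. square r k)" if "x \<in> B" for x
  proof -
    have "\<bar>fst x\<bar> \<le> b" "\<bar>snd x\<bar> \<le> b"
      using b[OF that] norm_fst_le[of "fst x" "snd x"] norm_snd_le[of "snd x" "fst x"] by auto
    then have "square_of r x \<in> grid n" using fl by (simp add: grid_def square_of_def)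
    moreover have "x \<in> square r (square_of r x)" using in_square_iff[OF assms(1)] by blast
    ultimately show ?thesis by blast
  qed
  then show thesis using that by blast
qed

context positive_CA_network
begin

text \<open>A bounded set is covered by finitely many squares, and its count in each is the
  indicator of a hit event. Hit probabilities are linear in the area with the same factor for all
  squares, which is all that a constant intensity requires.\<close>

lemma has_intensity_Psi: "has_intensity M \<Psi> active_intensity"
  unfolding has_intensity_def
proof (intro conjI ballI impI)
  show "active_intensity \<ge> 0" by (rule active_intensity_nonneg)
  fix B :: "plane set" assume B: "B \<in> sets borel" "bounded B"
  obtain n where n: "B \<subseteq> (\<Union>k\<in>grid n. square r_gz k)"
    using bounded_subset_squares[OF r_pos B(2)] .
  have card_eq: "ennreal (real (card (\<Psi> \<omega> \<inter> B))) = (\<Sum>k\<in>grid n. indicator (hit (B \<inter> square r_gz k)) \<omega>)"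
    if \<omega>: "\<omega> \<in> space M" for \<omega>
  proof -
    have one: "real (card (\<Psi> \<omega> \<inter> (B \<inter> square r_gz k))) = indicator (hit (B \<inter> square r_gz k)) \<omega>" for k
    proof -
      have eq: "\<Psi> \<omega> \<inter> (B \<inter> square r_gz k) = \<Psi> \<omega> \<inter> square r_gz k \<inter> B" by blast
      show ?thesis
        by (rule Psi_square_cases[OF \<omega>, of k]) (use \<omega> in \<open>simp_all add: eq hit_def indicator_def\<close>)
    qed
    have "\<Psi> \<omega> \<inter> B = (\<Union>k\<in>grid n. \<Psi> \<omega> \<inter> (B \<inter> square r_gz k))" using n by blast
    also have "card \<dots> = (\<Sum>k\<in>grid n. card (\<Psi> \<omega> \<inter> (B \<inter> square r_gz k)))"
    proof (rule card_UN_disjoint)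
      show "\<forall>k\<in>grid n. finite (\<Psi> \<omega> \<inter> (B \<inter> square r_gz k))"
        by (intro ballI finite_subset[OF _ finite_Psi_Int[OF \<omega> B(2)]]) blast
      show "\<forall>k\<in>grid n. \<forall>l\<in>grid n. k \<noteq> l \<longrightarrow>
          \<Psi> \<omega> \<inter> (B \<inter> square r_gz k) \<inter> (\<Psi> \<omega> \<inter> (B \<inter> square r_gz l)) = {}"
        using disjoint_squares[OF r_pos] by blast
    qed (rule finite_grid)
    finally have "real (card (\<Psi> \<omega> \<inter> B)) = (\<Sum>k\<in>grid n. indicator (hit (B \<inter> square r_gz k)) \<omega>)"
      by (simp only: of_nat_sum one)
    then show ?thesis by (simp add: sum_ennreal[symmetric] ennreal_indicator)
  qed
  have "(\<integral>\<^sup>+\<omega>. ennreal (real (card (\<Psi> \<omega> \<inter> B))) \<partial>M) =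
      (\<integral>\<^sup>+\<omega>. (\<Sum>k\<in>grid n. indicator (hit (B \<inter> square r_gz k)) \<omega>) \<partial>M)"
    by (intro nn_integral_cong card_eq)
  also have "\<dots> = (\<Sum>k\<in>grid n. emeasure M (hit (B \<inter> square r_gz k)))"
  proof -
    have "hit (B \<inter> square r_gz k) \<in> events" for k
      using B by (intro hit_square_events[of _ k]) auto
    then show ?thesis by (subst nn_integral_sum) auto
  qed
  also have "\<dots> = (\<Sum>k\<in>grid n. ennreal (active_intensity * measure lborel (B \<inter> square r_gz k)))"
  proof (intro sum.cong refl)
    fix k show "emeasure M (hit (B \<inter> square r_gz k)) = ennreal (active_intensity * measure lborel (B \<inter> square r_gz k))"
      using B prob_hit[of "B \<inter> square r_gz k" k] by (simp add: emeasure_eq_measure)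
  qed
  also have "\<dots> = ennreal (\<Sum>k\<in>grid n. active_intensity * measure lborel (B \<inter> square r_gz k))"
    using active_intensity_nonneg by (intro sum_ennreal) auto
  also have "(\<Sum>k\<in>grid n. active_intensity * measure lborel (B \<inter> square r_gz k)) = active_intensity * measure lborel B"
  proof -
    have "measure lborel (\<Union>k\<in>grid n. B \<inter> square r_gz k) = (\<Sum>k\<in>grid n. measure lborel (B \<inter> square r_gz k))"
    proof (rule measure_finite_Union)
      show "disjoint_family_on (\<lambda>k. B \<inter> square r_gz k) (grid n)"
        using disjoint_squares[OF r_pos] unfolding disjoint_family_on_def by blast
      show "emeasure lborel (B \<inter> square r_gz k) \<noteq> \<infinity>" for k
        using emeasure_mono[of "B \<inter> square r_gz k" "square r_gz k" lborel] emeasure_square[OF r_pos, of k]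
        by (auto simp: top_unique)
    qed (use B finite_grid in auto)
    moreover have "(\<Union>k\<in>grid n. B \<inter> square r_gz k) = B" using n by blast
    ultimately show ?thesis by (simp add: sum_distrib_left)
  qed
  finally show "(\<integral>\<^sup>+\<omega>. ennreal (real (card (\<Psi> \<omega> \<inter> B))) \<partial>M) = ennreal (active_intensity * measure lborel B)" .
qed

section \<open>Interference as a sum over squares\<close>

lemma gain_measurable [measurable]: "h k \<in> borel_measurable M"
  using distributed_measurable[OF gains_exponential[of k]] by simp

text \<open>The path loss of the active transmitter in square \<open>k\<close>, or 0 if there is
  none: a sum over at most one point avoids choosing that point.\<close>

definition path_sum :: "real \<Rightarrow> int \<times> int \<Rightarrow> 'a \<Rightarrow> real" where
  "path_sum \<alpha> k \<omega> = (\<Sum>x\<in>\<Psi> \<omega> \<inter> square r_gz k. norm x powr (- \<alpha>))"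

lemma path_sum_nonneg: "path_sum \<alpha> k \<omega> \<ge> 0"
  unfolding path_sum_def by (intro sum_nonneg) auto

lemma path_sum_measurable [measurable]: "path_sum \<alpha> k \<in> borel_measurable M"
  unfolding path_sum_def[abs_def] by (rule active_sum_measurable) measurable

lemma sum_interferers:
  assumes \<omega>: "\<omega> \<in> space M" and K: "finite K"
  shows "(\<Sum>x\<in>(\<Union>k\<in>K. \<Psi> \<omega> \<inter> square r_gz k). ennreal (norm x powr (- \<alpha>) * h (square_of r_gz x) \<omega>)) =
    (\<Sum>k\<in>K. ennreal (path_sum \<alpha> k \<omega>) * ennreal (h k \<omega>))"
proof -
  have "(\<Sum>x\<in>(\<Union>k\<in>K. \<Psi> \<omega> \<inter> square r_gz k). ennreal (norm x powr (- \<alpha>) * h (square_of r_gz x) \<omega>)) =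
      (\<Sum>k\<in>K. \<Sum>x\<in>\<Psi> \<omega> \<inter> square r_gz k. ennreal (norm x powr (- \<alpha>) * h (square_of r_gz x) \<omega>))"
    using K finite_Psi_Int[OF \<omega> bounded_square] disjoint_squares[OF r_pos]
    by (intro sum.UNION_disjoint) blast+
  also have "\<dots> = (\<Sum>k\<in>K. ennreal (path_sum \<alpha> k \<omega>) * ennreal (h k \<omega>))"
  proof (intro sum.cong refl)
    fix k
    \<comment> \<open>Gains are nonnegative only almost surely. The product rule still holds, since
      the path loss is nonnegative and \<open>ennreal\<close> sends negative reals to 0.\<close>
    have "(\<Sum>x\<in>\<Psi> \<omega> \<inter> square r_gz k. ennreal (norm x powr (- \<alpha>) * h (square_of r_gz x) \<omega>)) =
        (\<Sum>x\<in>\<Psi> \<omega> \<inter> square r_gz k. ennreal (norm x powr (- \<alpha>)) * ennreal (h k \<omega>))"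
      using in_square_iff[OF r_pos] by (intro sum.cong refl) (simp add: ennreal_mult')
    also have "\<dots> = ennreal (path_sum \<alpha> k \<omega>) * ennreal (h k \<omega>)"
      by (simp add: path_sum_def sum_distrib_right[symmetric] sum_ennreal)
    finally show "(\<Sum>x\<in>\<Psi> \<omega> \<inter> square r_gz k. ennreal (norm x powr (- \<alpha>) * h (square_of r_gz x) \<omega>)) =
        ennreal (path_sum \<alpha> k \<omega>) * ennreal (h k \<omega>)" .
  qed
  finally show ?thesis .
qed

lemma interferers_in_squares:
  "(\<Union>k\<in>K - {(0, 0)}. \<Psi> \<omega> \<inter> square r_gz k) \<subseteq> \<Psi> \<omega> - square r_gz (0, 0)"
  using disjoint_squares[OF r_pos] by blast

text \<open>A sum in \<open>ennreal\<close> is the supremum of its finite partial sums, so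
  discarding all but finitely many squares can only lower it. The coverage bound uses this
  direction.\<close>

lemma interference_ge:
  assumes \<omega>: "\<omega> \<in> space M" and K: "finite K"
  shows "(\<Sum>k\<in>K - {(0, 0)}. ennreal (path_sum \<alpha> k \<omega>) * ennreal (h k \<omega>)) \<le> interference \<alpha> r_gz \<Psi> h \<omega>"
proof -
  let ?A = "\<Union>k\<in>K - {(0, 0)}. \<Psi> \<omega> \<inter> square r_gz k"
  have "finite ?A" using K finite_Psi_Int[OF \<omega> bounded_square] by blast
  then have "(\<Sum>x\<in>?A. ennreal (norm x powr (- \<alpha>) * h (square_of r_gz x) \<omega>)) \<le> interference \<alpha> r_gz \<Psi> h \<omega>"
    using interferers_in_squares[where K = K and \<omega> = \<omega>] unfolding interference_def
    by (subst nonneg_infsum_complete) (auto intro!: SUP_upper)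
  then show ?thesis using sum_interferers[OF \<omega>, of "K - {(0, 0)}"] K by simp
qed

text \<open>Serves measurability: the finite subsets of a random set form no fixed countable family,
  but the grids do, and each finite set of interferers lies in the squares of some grid.\<close>

lemma interference_eq_SUP:
  assumes \<omega>: "\<omega> \<in> space M"
  shows "interference \<alpha> r_gz \<Psi> h \<omega> =
    (SUP n. \<Sum>k\<in>grid n - {(0, 0)}. ennreal (path_sum \<alpha> k \<omega>) * ennreal (h k \<omega>))"
proof (rule antisym)
  show "(SUP n. \<Sum>k\<in>grid n - {(0, 0)}. ennreal (path_sum \<alpha> k \<omega>) * ennreal (h k \<omega>)) \<le> interference \<alpha> r_gz \<Psi> h \<omega>"
    by (intro SUP_least interference_ge \<omega> finite_grid)
  let ?f = "\<lambda>x. ennreal (norm x powr (- \<alpha>) * h (square_of r_gz x) \<omega>)"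
  show "interference \<alpha> r_gz \<Psi> h \<omega> \<le>
      (SUP n. \<Sum>k\<in>grid n - {(0, 0)}. ennreal (path_sum \<alpha> k \<omega>) * ennreal (h k \<omega>))"
    unfolding interference_def
  proof (subst nonneg_infsum_complete, simp, rule SUP_least)
    fix F assume "F \<in> {F. finite F \<and> F \<subseteq> \<Psi> \<omega> - square r_gz (0, 0)}"
    then have F: "finite F" "F \<subseteq> \<Psi> \<omega> - square r_gz (0, 0)" by auto
    obtain n where n: "square_of r_gz ` F \<subseteq> grid n"
      using finite_subset_grid[OF finite_imageI[OF F(1)]] .
    have "F \<subseteq> (\<Union>k\<in>grid n - {(0, 0)}. \<Psi> \<omega> \<inter> square r_gz k)"
    proof
      fix x assume x: "x \<in> F"
      have sq: "x \<in> square r_gz (square_of r_gz x)" using in_square_iff[OF r_pos] by blast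
      then have "square_of r_gz x \<in> grid n - {(0, 0)}" using x n F(2) by fastforce
      then show "x \<in> (\<Union>k\<in>grid n - {(0, 0)}. \<Psi> \<omega> \<inter> square r_gz k)" using x sq F(2) by blast
    qed
    moreover have "finite (\<Union>k\<in>grid n - {(0, 0)}. \<Psi> \<omega> \<inter> square r_gz k)"
      by (intro finite_UN_I finite_Diff finite_grid finite_Psi_Int[OF \<omega> bounded_square])
    ultimately have "sum ?f F \<le> sum ?f (\<Union>k\<in>grid n - {(0, 0)}. \<Psi> \<omega> \<inter> square r_gz k)"
      by (intro sum_mono2) (assumption | simp)+
    also have "\<dots> = (\<Sum>k\<in>grid n - {(0, 0)}. ennreal (path_sum \<alpha> k \<omega>) * ennreal (h k \<omega>))"
      using finite_grid by (intro sum_interferers \<omega>) auto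
    finally show "sum ?f F \<le> (SUP n. \<Sum>k\<in>grid n - {(0, 0)}. ennreal (path_sum \<alpha> k \<omega>) * ennreal (h k \<omega>))"
      by (meson SUP_upper2 UNIV_I)
  qed
qed

lemma interference_measurable [measurable]: "interference \<alpha> r_gz \<Psi> h \<in> borel_measurable M"
proof -
  have "(\<lambda>\<omega>. SUP n. \<Sum>k\<in>grid n - {(0, 0)}. ennreal (path_sum \<alpha> k \<omega>) * ennreal (h k \<omega>)) \<in> borel_measurable M"
    by measurable
  then show ?thesis by (subst measurable_cong[OF interference_eq_SUP])
qed

lemma sinr_measurable [measurable]: "sinr \<alpha> \<rho> r_tr r_gz \<Psi> h \<in> borel_measurable M"
  unfolding sinr_def[abs_def] by measurable

end

section \<open>The coverage probability\<close>

text \<open>\<open>exp (- (a * t))\<close> times the density of rate 1 is \<open>1 / (1 + a)\<close>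
  times the density of rate \<open>1 + a\<close>, which has total mass 1.\<close>

lemma nn_integral_exponential_laplace:
  fixes a :: real
  assumes "a \<ge> 0"
  shows "(\<integral>\<^sup>+t. ennreal (exponential_density 1 t) * ennreal (exp (- (a * t))) \<partial>lborel) = ennreal (1 / (1 + a))"
proof -
  interpret P: prob_space "density lborel (exponential_density (1 + a))"
    using assms by (intro prob_space_exponential_density) simp
  have total: "(\<integral>\<^sup>+t. ennreal (exponential_density (1 + a) t) \<partial>lborel) = 1"
    using P.emeasure_space_1 by (simp add: emeasure_density)
  have "(\<integral>\<^sup>+t. ennreal (exponential_density 1 t) * ennreal (exp (- (a * t))) \<partial>lborel) =
      (\<integral>\<^sup>+t. ennreal (1 / (1 + a)) * ennreal (exponential_density (1 + a) t) \<partial>lborel)"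
  proof (rule nn_integral_cong)
    fix t :: real
    have "exponential_density 1 t * exp (- (a * t)) = 1 / (1 + a) * exponential_density (1 + a) t"
    proof -
      have "exp (- t) * exp (- (a * t)) = exp (- (t * (1 + a)))"
        by (simp add: mult_exp_exp algebra_simps)
      then show ?thesis using assms by (simp add: exponential_density_def)
    qed
    then show "ennreal (exponential_density 1 t) * ennreal (exp (- (a * t))) =
        ennreal (1 / (1 + a)) * ennreal (exponential_density (1 + a) t)"
      using assms by (simp only: ennreal_mult''[symmetric] ennreal_mult'[symmetric] exp_ge_zero
          divide_nonneg_nonneg zero_le_one add_nonneg_nonneg)
  qed
  also have "\<dots> = ennreal (1 / (1 + a))"
    by (subst nn_integral_cmult) (auto simp: total)
  finally show ?thesis .
qed

section \<open>Independence of path losses and gains\<close>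

context positive_CA_network
begin

text \<open>One family holds the path losses (\<open>Inl\<close>) and the gains (\<open>Inr\<close>)
  of all squares. Independence is checked on generators: hit events for a path loss, preimages for a
  gain. There \<open>gains_indep_locations\<close> splits a finite intersection into two halves,
  \<open>prob_active\<close> factors the half of the locations, and \<open>gains_indep\<close> the
  other.\<close>

lemma indep_path_sums_gains:
  "indep_vars (\<lambda>_. borel) (case_sum (path_sum \<alpha>) h) UNIV"
  unfolding indep_vars_def
proof (intro conjI ballI)
  show "random_variable borel (case_sum (path_sum \<alpha>) h i)" for i
    by (cases i) simp_all
  define G where "G = case_sum (\<lambda>k. {hit B | B. B \<in> sets borel \<and> B \<subseteq> square r_gz k})
    (\<lambda>k. {h k -` C \<inter> space M | C. C \<in> sets borel})"
  have G_events: "G i \<subseteq> events" for i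
  proof (cases i)
    case (Inl k)
    then show ?thesis using hit_square_events[where k = k] by (auto simp: G_def)
  next
    case (Inr k)
    then show ?thesis by (auto simp: G_def)
  qed
  have "indep_sets G UNIV"
  proof (rule indep_setsI[OF G_events])
    fix A :: "int \<times> int + int \<times> int \<Rightarrow> 'a set" and J
    assume J: "finite J" and A: "\<forall>j\<in>J. A j \<in> G j" "J \<noteq> {}"
    define K1 K2 where "K1 = Inl -` J" and "K2 = Inr -` J"
    have J_eq: "J = K1 <+> K2"
    proof (rule set_eqI)
      fix j show "j \<in> J \<longleftrightarrow> j \<in> K1 <+> K2"
        by (cases j) (auto simp: K1_def K2_def)
    qed
    have fin: "finite K1" "finite K2"
      using J by (auto simp: K1_def K2_def intro: finite_vimageI)
    have "\<forall>k\<in>K1. \<exists>B. A (Inl k) = hit B \<and> B \<in> sets borel \<and> B \<subseteq> square r_gz k"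
      using A(1) by (fastforce simp: K1_def G_def)
    then obtain B where B: "\<And>k. k \<in> K1 \<Longrightarrow> A (Inl k) = hit (B k)"
      "\<And>k. k \<in> K1 \<Longrightarrow> B k \<in> sets borel" "\<And>k. k \<in> K1 \<Longrightarrow> B k \<subseteq> square r_gz k" by metis
    have "\<forall>k\<in>K2. \<exists>C. A (Inr k) = h k -` C \<inter> space M \<and> C \<in> sets borel"
      using A(1) by (fastforce simp: K2_def G_def)
    then obtain C where C: "\<And>k. k \<in> K2 \<Longrightarrow> A (Inr k) = h k -` C k \<inter> space M"
      "\<And>k. k \<in> K2 \<Longrightarrow> C k \<in> sets borel" by metis
    define a where "a = {\<omega> \<in> space M. \<forall>k\<in>K1. \<Psi> \<omega> \<inter> B k \<noteq> {}}"
    define b where "b = {\<omega> \<in> space M. \<forall>k\<in>K2. h k \<omega> \<in> C k}"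
    have sub: "(\<Inter>j\<in>J. A j) \<subseteq> space M"
    proof -
      obtain j where "j \<in> J" using A(2) by blast
      then have "A j \<in> events" using A(1) G_events[of j] by blast
      then show ?thesis using sets.sets_into_space \<open>j \<in> J\<close> by blast
    qed
    have "\<omega> \<in> (\<Inter>j\<in>J. A j) \<longleftrightarrow> \<omega> \<in> a \<inter> b" if "\<omega> \<in> space M" for \<omega>
    proof -
      have "\<omega> \<in> (\<Inter>j\<in>J. A j) \<longleftrightarrow> (\<forall>k\<in>K1. \<omega> \<in> A (Inl k)) \<and> (\<forall>k\<in>K2. \<omega> \<in> A (Inr k))"
        unfolding J_eq by blast
      then show ?thesis using that B(1) C(1) by (simp add: a_def b_def hit_def)
    qed
    then have inter: "(\<Inter>j\<in>J. A j) = a \<inter> b" using sub by (auto simp: a_def)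
    \<comment> \<open>The assumption speaks of the sigma-algebra generated by \<open>\<Phi>\<close>
      and \<open>\<Psi>\<close>, so hitting a set is rewritten as a nonzero count, which is
      measurable in the configuration.\<close>
    have "a \<in> sets (vimage_algebra (space M) (\<lambda>\<omega>. (\<Phi> \<omega>, \<Psi> \<omega>)) (config_space \<Otimes>\<^sub>M config_space))"
    proof -
      let ?X = "{z \<in> space (config_space \<Otimes>\<^sub>M config_space). \<forall>k\<in>K1. card (snd z \<inter> B k) \<noteq> 0}"
      have [measurable]: "(\<lambda>z. card (snd z \<inter> B k)) \<in> config_space \<Otimes>\<^sub>M config_space \<rightarrow>\<^sub>M count_space UNIV" if "k \<in> K1" for k
        by (rule measurable_compose[OF measurable_snd
              measurable_card_Int[OF B(2)[OF that] bounded_subset[OF bounded_square B(3)[OF that]]]])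
      have "?X \<in> sets (config_space \<Otimes>\<^sub>M config_space)"
        using fin by measurable
      then have "(\<lambda>\<omega>. (\<Phi> \<omega>, \<Psi> \<omega>)) -` ?X \<inter> space M \<in>
          sets (vimage_algebra (space M) (\<lambda>\<omega>. (\<Phi> \<omega>, \<Psi> \<omega>)) (config_space \<Otimes>\<^sub>M config_space))"
        by (rule in_vimage_algebra)
      also have "(\<lambda>\<omega>. (\<Phi> \<omega>, \<Psi> \<omega>)) -` ?X \<inter> space M = a"
      proof -
        have "0 < card (\<Psi> \<omega> \<inter> B k) \<longleftrightarrow> \<Psi> \<omega> \<inter> B k \<noteq> {}" if "\<omega> \<in> space M" "k \<in> K1" for \<omega> k
          using finite_Psi_Int[OF that(1) bounded_subset[OF bounded_square B(3)[OF that(2)]]]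
          by (simp add: card_gt_0_iff)
        then have "(\<Phi> \<omega>, \<Psi> \<omega>) \<in> ?X \<longleftrightarrow> \<omega> \<in> a" if "\<omega> \<in> space M" for \<omega>
          using that measurable_space[OF Phi_measurable that] measurable_space[OF Psi_measurable that]
          by (simp add: a_def space_pair_measure)
        then show ?thesis by (auto simp: a_def)
      qed
      finally show ?thesis .
    qed
    moreover have "b \<in> sets (vimage_algebra (space M) (\<lambda>\<omega> k. h k \<omega>) (\<Pi>\<^sub>M k\<in>UNIV. borel))"
    proof -
      let ?Y = "{f \<in> space (\<Pi>\<^sub>M k\<in>UNIV. borel). \<forall>k\<in>K2. f k \<in> C k}"
      have "?Y \<in> sets (\<Pi>\<^sub>M k\<in>UNIV. borel)"
      proof (intro sets.sets_Collect_finite_All fin)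
        fix k assume k: "k \<in> K2"
        have "(\<lambda>f. f k) \<in> borel_measurable (\<Pi>\<^sub>M k\<in>(UNIV :: (int \<times> int) set). (borel :: real measure))"
          by (rule measurable_component_singleton) simp
        from measurable_sets[OF this C(2)[OF k]] show "{f \<in> space (\<Pi>\<^sub>M k\<in>(UNIV :: (int \<times> int) set). (borel :: real measure)). f k \<in> C k} \<in>
            sets (\<Pi>\<^sub>M k\<in>UNIV. borel)"
          by (simp add: vimage_def Int_def conj_commute)
      qed
      then have "(\<lambda>\<omega> k. h k \<omega>) -` ?Y \<inter> space M \<in>
          sets (vimage_algebra (space M) (\<lambda>\<omega> k. h k \<omega>) (\<Pi>\<^sub>M k\<in>UNIV. borel))"
        by (rule in_vimage_algebra)
      also have "(\<lambda>\<omega> k. h k \<omega>) -` ?Y \<inter> space M = b"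
        by (auto simp: b_def space_PiM)
      finally show ?thesis .
    qed
    ultimately have "prob (a \<inter> b) = prob a * prob b"
      by (rule indep_setD[OF gains_indep_locations])
    also have "prob a = (\<Prod>k\<in>K1. prob (A (Inl k)))"
    proof -
      \<comment> \<open>The joint and the single hit probabilities come from one formula; comparing
        them is the independence.\<close>
      have "prob a = (\<Prod>k\<in>K1. active_intensity * measure lborel (B k))"
        unfolding a_def by (rule prob_active[OF fin(1) B(2,3)])
      also have "\<dots> = (\<Prod>k\<in>K1. prob (A (Inl k)))"
        by (intro prod.cong refl) (simp add: B(1) prob_hit[OF B(2,3)])
      finally show ?thesis .
    qed
    also have "prob b = (\<Prod>k\<in>K2. prob (A (Inr k)))"
    proof (cases "K2 = {}")
      case True
      then show ?thesis by (simp add: b_def prob_space)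
    next
      case False
      then have "b = (\<Inter>k\<in>K2. h k -` C k \<inter> space M)" by (auto simp: b_def)
      also have "prob \<dots> = (\<Prod>k\<in>K2. prob (h k -` C k \<inter> space M))"
        by (rule indep_varsD[OF gains_indep False fin(2)]) (use C in auto)
      finally show ?thesis using C by simp
    qed
    finally show "prob (\<Inter>j\<in>J. A j) = (\<Prod>j\<in>J. prob (A j))"
      unfolding inter using fin by (simp add: J_eq prod.Plus)
  qed
  then have "indep_sets (\<lambda>i. sigma_sets (space M) (G i)) UNIV"
  proof (rule indep_sets_sigma)
    fix i :: "int \<times> int + int \<times> int"
    show "Int_stable (G i)"
    proof (cases i)
      case (Inl k)
      show ?thesis
      proof (rule Int_stableI)
        fix a b assume "a \<in> G i" "b \<in> G i"
        then obtain B C where "a = hit B" "b = hit C" "B \<in> sets borel" "C \<in> sets borel"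
          "B \<subseteq> square r_gz k" "C \<subseteq> square r_gz k"
          by (auto simp: G_def Inl)
        then have "a \<inter> b = hit (B \<inter> C)" "B \<inter> C \<in> sets borel" "B \<inter> C \<subseteq> square r_gz k"
          using hit_Int by auto
        then show "a \<inter> b \<in> G i" by (auto simp: G_def Inl)
      qed
    next
      case (Inr k)
      show ?thesis
      proof (rule Int_stableI)
        fix a b assume "a \<in> G i" "b \<in> G i"
        then obtain B C where "a = h k -` B \<inter> space M" "b = h k -` C \<inter> space M"
          "B \<in> sets borel" "C \<in> sets borel"
          by (auto simp: G_def Inr)
        then have "a \<inter> b = h k -` (B \<inter> C) \<inter> space M" "B \<inter> C \<in> sets borel" by auto
        then show "a \<inter> b \<in> G i" unfolding G_def Inr sum.case by blast
      qed
    qed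
  qed
  \<comment> \<open>By \<open>active_sum_sigma\<close>, a path loss generates no more than the hit
    events of its square do.\<close>
  then show "indep_sets (\<lambda>i. sigma_sets (space M) {case_sum (path_sum \<alpha>) h i -` A \<inter> space M | A. A \<in> sets borel}) UNIV"
  proof (rule indep_sets_mono_sets)
    fix i :: "int \<times> int + int \<times> int"
    show "sigma_sets (space M) {case_sum (path_sum \<alpha>) h i -` A \<inter> space M | A. A \<in> sets borel} \<subseteq>
        sigma_sets (space M) (G i)"
    proof (rule sigma_sets_mono, rule subsetI)
      fix X assume "X \<in> {case_sum (path_sum \<alpha>) h i -` A \<inter> space M | A. A \<in> sets borel}"
      then obtain A where X: "X = case_sum (path_sum \<alpha>) h i -` A \<inter> space M" "A \<in> sets borel" by auto
      show "X \<in> sigma_sets (space M) (G i)"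
      proof (cases i)
        case (Inl k)
        have "(\<lambda>x :: plane. norm x powr (- \<alpha>)) \<in> borel_measurable borel" by measurable
        from active_sum_sigma[OF this X(2), of k] show ?thesis
          by (simp add: X(1) Inl G_def path_sum_def[abs_def])
      next
        case (Inr k)
        then show ?thesis using X by (auto simp: G_def intro: sigma_sets.Basic)
      qed
    qed
  qed
qed

text \<open>Index \<open>(0, 0)\<close> carries the bare gain of the desired link, whose distance
  \<open>r_tr\<close> is prescribed by the model and not read off \<open>\<Psi>\<close>. Thus one
  independent family indexed by squares covers signal and interference.\<close>

definition received :: "real \<Rightarrow> int \<times> int \<Rightarrow> 'a \<Rightarrow> real" where
  "received \<alpha> k \<omega> = (if k = (0, 0) then h k \<omega> else path_sum \<alpha> k \<omega> * h k \<omega>)"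

lemma indep_received: "indep_vars (\<lambda>_. borel) (received \<alpha>) UNIV"
proof -
  let ?I = "\<lambda>k :: int \<times> int. {Inl k, Inr k}"
  let ?q = "\<lambda>k f. if k = (0, 0) then f (Inr k) else f (Inl k) * f (Inr k) :: real"
  have "indep_vars (\<lambda>k. \<Pi>\<^sub>M i\<in>?I k. borel) (\<lambda>k \<omega>. \<lambda>i\<in>?I k. case_sum (path_sum \<alpha>) h i \<omega>) UNIV"
    by (rule indep_vars_restrict[OF indep_path_sums_gains]) (auto simp: disjoint_family_on_def)
  then have "indep_vars (\<lambda>_. borel) (\<lambda>k \<omega>. ?q k (\<lambda>i\<in>?I k. case_sum (path_sum \<alpha>) h i \<omega>)) UNIV"
  proof (rule indep_vars_compose2)
    fix k :: "int \<times> int"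
    have [measurable]: "(\<lambda>f. f (Inl k)) \<in> borel_measurable (\<Pi>\<^sub>M i\<in>?I k. borel)"
      "(\<lambda>f. f (Inr k)) \<in> borel_measurable (\<Pi>\<^sub>M i\<in>?I k. borel)"
      by (auto intro: measurable_component_singleton)
    show "?q k \<in> borel_measurable (\<Pi>\<^sub>M i\<in>?I k. borel)"
      by measurable
  qed
  moreover have "(\<lambda>k \<omega>. ?q k (\<lambda>i\<in>?I k. case_sum (path_sum \<alpha>) h i \<omega>)) = received \<alpha>"
    by (intro ext) (simp add: received_def)
  ultimately show ?thesis by simp
qed

section \<open>Averaging over the gains\<close>

lemma indep_path_sum_gain: "indep_var borel (path_sum \<alpha> k) borel (h k)"
proof -
  have "indep_var
      borel ((\<lambda>f. f (Inl k)) \<circ> (\<lambda>\<omega>. restrict (\<lambda>i. case_sum (path_sum \<alpha>) h i \<omega>) {Inl k}))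
      borel ((\<lambda>f. f (Inr k)) \<circ> (\<lambda>\<omega>. restrict (\<lambda>i. case_sum (path_sum \<alpha>) h i \<omega>) {Inr k}))"
    by (rule indep_var_compose[OF indep_var_restrict[OF indep_path_sums_gains]])
       (auto intro: measurable_component_singleton)
  then show ?thesis by (simp add: comp_def)
qed

text \<open>The joint law is a product, so the gain can be integrated first, against its density.
  \<open>U\<close> will be the interference of finitely many squares for the desired gain, and a
  path loss for an interfering one.\<close>

lemma nn_integral_indep_gain:
  assumes ind: "indep_var borel U borel (h k)"
    and f [measurable]: "f \<in> borel_measurable (borel \<Otimes>\<^sub>M borel)"
  shows "(\<integral>\<^sup>+\<omega>. f (U \<omega>, h k \<omega>) \<partial>M) =
    (\<integral>\<^sup>+\<omega>. \<integral>\<^sup>+t. ennreal (exponential_density 1 t) * f (U \<omega>, t) \<partial>lborel \<partial>M)"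
proof -
  have [measurable]: "U \<in> borel_measurable M" using indep_var_rv1[OF ind] .
  have dh: "distr M borel (h k) = density lborel (\<lambda>t. ennreal (exponential_density 1 t))"
    using distributed_distr_eq_density[OF gains_exponential[of k]]
    by (metis distr_cong sets_lborel)
  interpret H: prob_space "distr M borel (h k)" by (rule prob_space_distr) simp
  interpret H': prob_space "distr M borel U" by (rule prob_space_distr) simp
  interpret P: pair_prob_space "distr M borel U" "distr M borel (h k)" ..
  have "(\<integral>\<^sup>+\<omega>. f (U \<omega>, h k \<omega>) \<partial>M) = (\<integral>\<^sup>+z. f z \<partial>distr M (borel \<Otimes>\<^sub>M borel) (\<lambda>\<omega>. (U \<omega>, h k \<omega>)))"
    by (subst nn_integral_distr) auto
  also have "\<dots> = (\<integral>\<^sup>+z. f z \<partial>(distr M borel U \<Otimes>\<^sub>M distr M borel (h k)))"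
    using ind by (simp add: indep_var_distribution_eq)
  also have "\<dots> = (\<integral>\<^sup>+u. \<integral>\<^sup>+t. f (u, t) \<partial>distr M borel (h k) \<partial>distr M borel U)"
    by (rule H.nn_integral_fst[symmetric]) simp
  also have "\<dots> = (\<integral>\<^sup>+\<omega>. \<integral>\<^sup>+t. f (U \<omega>, t) \<partial>distr M borel (h k) \<partial>M)"
    by (subst nn_integral_distr) auto
  also have "\<dots> = (\<integral>\<^sup>+\<omega>. \<integral>\<^sup>+t. ennreal (exponential_density 1 t) * f (U \<omega>, t) \<partial>lborel \<partial>M)"
    unfolding dh by (intro nn_integral_cong nn_integral_density) auto
  finally show ?thesis .
qed

lemma nn_integral_exponential_tail:
  "(\<integral>\<^sup>+t. ennreal (exponential_density 1 t) * indicator {a<..} t \<partial>lborel) \<le> ennreal (exp (- a))"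
proof -
  \<comment> \<open>The gain \<open>h ?k\<close> merely provides a random variable with the
    exponential law, to which the known tail formula applies.\<close>
  let ?k = "(0, 0) :: int \<times> int"
  have "(\<integral>\<^sup>+t. ennreal (exponential_density 1 t) * indicator {a<..} t \<partial>lborel) =
      (\<integral>\<^sup>+\<omega>. indicator {a<..} (h ?k \<omega>) \<partial>M)"
    by (rule distributed_nn_integral[OF gains_exponential]) simp
  also have "\<dots> = (\<integral>\<^sup>+\<omega>. indicator {\<omega> \<in> space M. a < h ?k \<omega>} \<omega> \<partial>M)"
    by (intro nn_integral_cong) (simp add: indicator_def)
  also have "\<dots> = emeasure M {\<omega> \<in> space M. a < h ?k \<omega>}"
    by (rule nn_integral_indicator) measurable
  also have "\<dots> \<le> ennreal (exp (- a))"
  proof (cases "a \<ge> 0")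
    case True
    then show ?thesis
      using exponential_distributedD_gt[OF gains_exponential[of ?k], of a] by (simp add: emeasure_eq_measure)
  next
    case False
    then have "prob {\<omega> \<in> space M. a < h ?k \<omega>} \<le> exp (- a)"
      by (intro order_trans[OF prob_le_1]) simp
    then show ?thesis by (simp add: emeasure_eq_measure)
  qed
  finally show ?thesis .
qed

lemma emeasure_gain_gt_le:
  assumes ind: "indep_var borel T borel (h k)"
  shows "emeasure M {\<omega> \<in> space M. s * T \<omega> + c < h k \<omega>} \<le> (\<integral>\<^sup>+\<omega>. ennreal (exp (- (s * T \<omega> + c))) \<partial>M)"
proof -
  have [measurable]: "T \<in> borel_measurable M" using indep_var_rv1[OF ind] .
  let ?f = "\<lambda>z :: real \<times> real. indicator {z \<in> space (borel \<Otimes>\<^sub>M borel). s * fst z + c < snd z} z :: ennreal"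
  have f: "?f \<in> borel_measurable (borel \<Otimes>\<^sub>M borel)" by measurable
  have "emeasure M {\<omega> \<in> space M. s * T \<omega> + c < h k \<omega>} =
      (\<integral>\<^sup>+\<omega>. indicator {\<omega> \<in> space M. s * T \<omega> + c < h k \<omega>} \<omega> \<partial>M)"
    by (rule nn_integral_indicator[symmetric]) measurable
  also have "\<dots> = (\<integral>\<^sup>+\<omega>. ?f (T \<omega>, h k \<omega>) \<partial>M)"
    by (intro nn_integral_cong) (simp add: indicator_def space_pair_measure)
  also have "\<dots> = (\<integral>\<^sup>+\<omega>. \<integral>\<^sup>+t. ennreal (exponential_density 1 t) * ?f (T \<omega>, t) \<partial>lborel \<partial>M)"
    by (rule nn_integral_indep_gain[OF ind f])
  also have "\<dots> = (\<integral>\<^sup>+\<omega>. \<integral>\<^sup>+t. ennreal (exponential_density 1 t) * indicator {s * T \<omega> + c<..} t \<partial>lborel \<partial>M)"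
    by (intro nn_integral_cong) (simp add: indicator_def space_pair_measure)
  also have "\<dots> \<le> (\<integral>\<^sup>+\<omega>. ennreal (exp (- (s * T \<omega> + c))) \<partial>M)"
    by (intro nn_integral_mono nn_integral_exponential_tail)
  finally show ?thesis .
qed

lemma nn_integral_laplace_received:
  assumes "s \<ge> 0"
  shows "(\<integral>\<^sup>+\<omega>. ennreal (exp (- (s * (path_sum \<alpha> k \<omega> * h k \<omega>)))) \<partial>M) =
    (\<integral>\<^sup>+\<omega>. ennreal (1 / (1 + s * path_sum \<alpha> k \<omega>)) \<partial>M)"
proof -
  let ?f = "\<lambda>z :: real \<times> real. ennreal (exp (- (s * (fst z * snd z))))"
  have f: "?f \<in> borel_measurable (borel \<Otimes>\<^sub>M borel)" by measurable
  have "(\<integral>\<^sup>+\<omega>. ennreal (exp (- (s * (path_sum \<alpha> k \<omega> * h k \<omega>)))) \<partial>M) =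
      (\<integral>\<^sup>+\<omega>. \<integral>\<^sup>+t. ennreal (exponential_density 1 t) * ennreal (exp (- (s * (path_sum \<alpha> k \<omega> * t)))) \<partial>lborel \<partial>M)"
    using nn_integral_indep_gain[OF indep_path_sum_gain[of \<alpha> k] f] by simp
  also have "\<dots> = (\<integral>\<^sup>+\<omega>. ennreal (1 / (1 + s * path_sum \<alpha> k \<omega>)) \<partial>M)"
    using nn_integral_exponential_laplace[OF mult_nonneg_nonneg[OF assms path_sum_nonneg]]
    by (intro nn_integral_cong) (simp add: mult.assoc)
  finally show ?thesis .
qed

text \<open>With path loss \<open>1 / w\<close> the identity
  \<open>1 / (1 + s / w) + s / (s + w) = 1\<close> holds pointwise, and a square without active
  transmitter gives \<open>1 + 0\<close>; Campbell's formula takes the mean. Stating a sum avoids a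
  difference in \<open>ennreal\<close>.\<close>

lemma nn_integral_inverse_path_sum:
  assumes "s > 0" "k \<noteq> (0, 0)"
  shows "(\<integral>\<^sup>+\<omega>. ennreal (1 / (1 + s * path_sum \<alpha> k \<omega>)) \<partial>M) +
    ennreal active_intensity * (\<integral>\<^sup>+x. ennreal (s / (s + ((norm x)\<^sup>2) powr (\<alpha> / 2))) * indicator (square r_gz k) x \<partial>lborel) = 1"
proof -
  let ?g = "\<lambda>x :: plane. ennreal (s / (s + ((norm x)\<^sup>2) powr (\<alpha> / 2)))"
  have one: "ennreal (1 / (1 + s * path_sum \<alpha> k \<omega>)) + (\<Sum>x\<in>\<Psi> \<omega> \<inter> square r_gz k. ?g x) = 1"
    if \<omega>: "\<omega> \<in> space M" for \<omega>
  proof (cases rule: Psi_square_cases[OF \<omega>, of k])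
    case 1
    then show ?thesis by (simp add: path_sum_def)
  next
    case (2 x)
    \<comment> \<open>The origin lies in square \<open>(0, 0)\<close>, hence is not the interferer.
      There the identity would fail, since \<open>0 powr (- \<alpha>)\<close> is 0 and not
      infinite.\<close>
    have "x \<in> square r_gz k" using 2 by blast
    moreover have "0 \<in> square r_gz (0, 0)" using r_pos by (auto simp: square_def zero_prod_def)
    ultimately have "x \<noteq> 0" using disjoint_squares[OF r_pos assms(2)] by blast
    then have nx: "norm x > 0" by simp
    define w where "w = norm x powr \<alpha>"
    have w: "w > 0" using nx by (simp add: w_def)
    have sq: "((norm x)\<^sup>2) powr (\<alpha> / 2) = w"
      using nx by (simp add: w_def powr_powr flip: powr_numeral)
    have Y: "path_sum \<alpha> k \<omega> = 1 / w"
      using 2 by (simp add: path_sum_def w_def powr_minus_divide)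
    have frac: "1 + s * (1 / w) = (s + w) / w"
      using w by (simp add: field_simps)
    have "1 / (1 + s * (1 / w)) + s / (s + w) = (w + s) / (s + w)"
      by (simp only: frac divide_divide_eq_right mult_1 add_divide_distrib[of w s "s + w"])
    also have "\<dots> = 1" using w assms(1) by simp
    finally have "1 / (1 + s * (1 / w)) + s / (s + w) = 1" .
    then show ?thesis
      using w assms(1) unfolding 2 by (simp add: Y sq ennreal_plus[symmetric] del: ennreal_plus)
  qed
  have "(\<integral>\<^sup>+\<omega>. ennreal (1 / (1 + s * path_sum \<alpha> k \<omega>)) \<partial>M) + (\<integral>\<^sup>+\<omega>. (\<Sum>x\<in>\<Psi> \<omega> \<inter> square r_gz k. ?g x) \<partial>M) =
      (\<integral>\<^sup>+\<omega>. ennreal (1 / (1 + s * path_sum \<alpha> k \<omega>)) + (\<Sum>x\<in>\<Psi> \<omega> \<inter> square r_gz k. ?g x) \<partial>M)"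
    by (rule nn_integral_add[symmetric]) (measurable, auto intro!: active_sum_measurable)
  also have "\<dots> = (\<integral>\<^sup>+\<omega>. 1 \<partial>M)"
    by (rule nn_integral_cong) (rule one)
  also have "\<dots> = 1" by (simp add: emeasure_space_1)
  finally show ?thesis
    by (subst (asm) campbell_square) auto
qed

text \<open>Solving the SINR inequality for the desired gain gives the threshold
  \<open>s * I + s / \<rho>\<close>, with \<open>I\<close> the interference and
  \<open>s = \<beta> * r_tr powr \<alpha>\<close>; keeping only the squares in \<open>K\<close>
  lowers it.\<close>

lemma sinr_gt_imp:
  assumes \<omega>: "\<omega> \<in> space M" and K: "finite K" "(0, 0) \<notin> K"
    and pos: "r_tr > 0" "\<rho> > 0" "\<beta> > 0"
    and gt: "sinr \<alpha> \<rho> r_tr r_gz \<Psi> h \<omega> > ennreal \<beta>"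
  shows "(\<beta> * r_tr powr \<alpha>) * (\<Sum>k\<in>K. received \<alpha> k \<omega>) + \<beta> * r_tr powr \<alpha> / \<rho> < received \<alpha> (0, 0) \<omega>"
proof (rule ccontr)
  let ?s = "\<beta> * r_tr powr \<alpha>"
  let ?I = "interference \<alpha> r_gz \<Psi> h \<omega>"
  assume "\<not> ?s * (\<Sum>k\<in>K. received \<alpha> k \<omega>) + ?s / \<rho> < received \<alpha> (0, 0) \<omega>"
  then have le: "h (0, 0) \<omega> \<le> ?s * (\<Sum>k\<in>K. received \<alpha> k \<omega>) + ?s / \<rho>" by (simp add: received_def)
  \<comment> \<open>\<open>interference\<close> counts negative gains as 0, \<open>received\<close>
    does not. The clipped sum \<open>T\<close> lies above the real sum and below the
    interference.\<close>
  define T where "T = (\<Sum>k\<in>K. path_sum \<alpha> k \<omega> * max 0 (h k \<omega>))"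
  have T0: "T \<ge> 0" unfolding T_def by (intro sum_nonneg mult_nonneg_nonneg path_sum_nonneg) simp
  have "(\<Sum>k\<in>K. received \<alpha> k \<omega>) \<le> T"
    unfolding T_def using K by (intro sum_mono) (auto simp: received_def intro!: mult_left_mono path_sum_nonneg)
  then have "?s * (\<Sum>k\<in>K. received \<alpha> k \<omega>) + ?s / \<rho> \<le> ?s * T + ?s / \<rho>"
    using pos by (intro add_right_mono mult_left_mono) auto
  with le have h0: "h (0, 0) \<omega> \<le> ?s * T + ?s / \<rho>" by linarith
  have "ennreal T = (\<Sum>k\<in>K - {(0, 0)}. ennreal (path_sum \<alpha> k \<omega>) * ennreal (h k \<omega>))"
  proof -
    have "ennreal T = (\<Sum>k\<in>K. ennreal (path_sum \<alpha> k \<omega> * max 0 (h k \<omega>)))"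
      unfolding T_def by (intro sum_ennreal[symmetric] mult_nonneg_nonneg path_sum_nonneg) simp
    also have "\<dots> = (\<Sum>k\<in>K. ennreal (path_sum \<alpha> k \<omega>) * ennreal (h k \<omega>))"
      by (intro sum.cong refl) (simp add: ennreal_mult' path_sum_nonneg ennreal_max_0)
    finally show ?thesis using K by simp
  qed
  then have TI: "ennreal T \<le> ?I" using interference_ge[OF \<omega> K(1), of \<alpha>] by simp
  have "\<rho> * r_tr powr (- \<alpha>) * h (0, 0) \<omega> \<le> \<rho> * r_tr powr (- \<alpha>) * (?s * T + ?s / \<rho>)"
    using pos h0 by (intro mult_left_mono) auto
  also have "\<dots> = \<beta> * (\<rho> * T + 1)"
    using pos by (simp add: powr_minus field_simps)
  finally have "ennreal (\<rho> * r_tr powr (- \<alpha>) * h (0, 0) \<omega>) \<le> ennreal (\<beta> * (\<rho> * T + 1))"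
    by (rule ennreal_leI)
  also have "\<dots> = ennreal \<beta> * (ennreal \<rho> * ennreal T + 1)"
  proof -
    have "ennreal (\<beta> * (\<rho> * T + 1)) = ennreal \<beta> * ennreal (\<rho> * T + 1)"
      using pos by (intro ennreal_mult') simp
    also have "ennreal (\<rho> * T + 1) = ennreal \<rho> * ennreal T + 1"
      using pos T0 by (simp add: ennreal_plus ennreal_mult)
    finally show ?thesis .
  qed
  also have "\<dots> \<le> ennreal \<beta> * (ennreal \<rho> * ?I + 1)"
    using TI by (intro mult_left_mono add_right_mono) auto
  finally have "ennreal (\<rho> * r_tr powr (- \<alpha>) * h (0, 0) \<omega>) \<le> (ennreal \<rho> * ?I + 1) * ennreal \<beta>"
    by (simp only: mult.commute)
  moreover have "0 < ennreal \<rho> * ?I + 1"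
    by (rule less_le_trans[OF zero_less_one]) (rule add_increasing[OF zero_le order_refl])
  ultimately have "sinr \<alpha> \<rho> r_tr r_gz \<Psi> h \<omega> \<le> ennreal \<beta>"
    unfolding sinr_def by (intro divide_le_posI_ennreal)
  with gt show False by simp
qed

section \<open>Coverage bounds for finitely many and for all interfering squares\<close>

lemma indep_set_sym:
  assumes "indep_set A B"
  shows "indep_set B A"
  unfolding indep_sets2_eq
proof (intro conjI ballI)
  show "B \<subseteq> events" "A \<subseteq> events"
    using indep_setD_ev1[OF assms] indep_setD_ev2[OF assms] by simp_all
  show "prob (b \<inter> a) = prob b * prob a" if "b \<in> B" "a \<in> A" for a b
    using indep_setD[OF assms that(2,1)] by (simp only: Int_commute mult.commute)
qed

lemma indep_var_sym: "indep_var S X T Y \<Longrightarrow> indep_var T Y S X"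
  unfolding indep_var_eq by (elim conjE, intro conjI, assumption, assumption, rule indep_set_sym)

text \<open>The Laplace transform factors over finitely many squares only, hence the finite
  \<open>K\<close>. The numbers \<open>\<gamma> k\<close> give the integrals over the squares as
  reals, so that they can stand in an exponent.\<close>

lemma coverage_le:
  assumes K: "finite K" "(0, 0) \<notin> K"
    and pos: "r_tr > 0" "\<rho> > 0" "\<beta> > 0" and s: "s = \<beta> * r_tr powr \<alpha>"
    and \<gamma>: "\<And>k. \<gamma> k \<ge> 0" "\<And>k. (\<integral>\<^sup>+x. ennreal (s / (s + ((norm x)\<^sup>2) powr (\<alpha> / 2))) * indicator (square r_gz k) x \<partial>lborel) = ennreal (\<gamma> k)"
  shows "prob {\<omega> \<in> space M. ennreal \<beta> < sinr \<alpha> \<rho> r_tr r_gz \<Psi> h \<omega>} \<le>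
    exp (- (s / \<rho>)) * exp (- (active_intensity * (\<Sum>k\<in>K. \<gamma> k)))"
proof -
  have s0: "s > 0" using pos s by simp
  let ?T = "\<lambda>\<omega>. \<Sum>k\<in>K. received \<alpha> k \<omega>"
  have ind: "indep_var borel ?T borel (h (0, 0))"
  proof -
    have "indep_var borel (received \<alpha> (0, 0)) borel ?T"
      by (rule indep_vars_sum[OF K indep_vars_subset[OF indep_received]]) simp
    then have "indep_var borel ?T borel (received \<alpha> (0, 0))"
      by (rule indep_var_sym)
    then show ?thesis by (simp add: received_def[abs_def])
  qed
  have [measurable]: "received \<alpha> k \<in> borel_measurable M" for k
    using indep_received[of \<alpha>] unfolding indep_vars_def by blast
  have "emeasure M {\<omega> \<in> space M. ennreal \<beta> < sinr \<alpha> \<rho> r_tr r_gz \<Psi> h \<omega>} \<le>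
      emeasure M {\<omega> \<in> space M. s * ?T \<omega> + s / \<rho> < h (0, 0) \<omega>}"
  proof (rule emeasure_mono)
    show "{\<omega> \<in> space M. ennreal \<beta> < sinr \<alpha> \<rho> r_tr r_gz \<Psi> h \<omega>} \<subseteq> {\<omega> \<in> space M. s * ?T \<omega> + s / \<rho> < h (0, 0) \<omega>}"
      using sinr_gt_imp[OF _ K pos] by (auto simp: s received_def)
    show "{\<omega> \<in> space M. s * ?T \<omega> + s / \<rho> < h (0, 0) \<omega>} \<in> events" by measurable
  qed
  also have "\<dots> \<le> (\<integral>\<^sup>+\<omega>. ennreal (exp (- (s * ?T \<omega> + s / \<rho>))) \<partial>M)"
    by (rule emeasure_gain_gt_le[OF ind])
  also have "\<dots> = (\<integral>\<^sup>+\<omega>. ennreal (exp (- (s / \<rho>))) * (\<Prod>k\<in>K. ennreal (exp (- (s * received \<alpha> k \<omega>)))) \<partial>M)"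
  proof (rule nn_integral_cong)
    fix \<omega>
    have "exp (- (s * ?T \<omega> + s / \<rho>)) = exp (- (s / \<rho>)) * (\<Prod>k\<in>K. exp (- (s * received \<alpha> k \<omega>)))"
      using K by (simp add: exp_sum[symmetric] mult_exp_exp sum_negf sum_distrib_left)
    then show "ennreal (exp (- (s * ?T \<omega> + s / \<rho>))) =
        ennreal (exp (- (s / \<rho>))) * (\<Prod>k\<in>K. ennreal (exp (- (s * received \<alpha> k \<omega>))))"
      by (simp add: ennreal_mult' prod_ennreal)
  qed
  also have "\<dots> = ennreal (exp (- (s / \<rho>))) * (\<integral>\<^sup>+\<omega>. (\<Prod>k\<in>K. ennreal (exp (- (s * received \<alpha> k \<omega>)))) \<partial>M)"
    by (rule nn_integral_cmult) measurable
  also have "(\<integral>\<^sup>+\<omega>. (\<Prod>k\<in>K. ennreal (exp (- (s * received \<alpha> k \<omega>)))) \<partial>M) =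
      (\<Prod>k\<in>K. \<integral>\<^sup>+\<omega>. ennreal (exp (- (s * received \<alpha> k \<omega>))) \<partial>M)"
  proof (rule indep_vars_nn_integral[OF K(1)])
    have "indep_vars (\<lambda>_. borel) (\<lambda>k \<omega>. (\<lambda>x. ennreal (exp (- (s * x)))) (received \<alpha> k \<omega>)) K"
      by (rule indep_vars_compose2[OF indep_vars_subset[OF indep_received]]) auto
    then show "indep_vars (\<lambda>_. borel) (\<lambda>k \<omega>. ennreal (exp (- (s * received \<alpha> k \<omega>)))) K" .
  qed simp
  also have "\<dots> \<le> (\<Prod>k\<in>K. ennreal (exp (- (active_intensity * \<gamma> k))))"
  proof (rule prod_mono_ennreal)
    fix k assume "k \<in> K"
    then have k: "k \<noteq> (0, 0)" using K by auto
    let ?E = "\<integral>\<^sup>+\<omega>. ennreal (1 / (1 + s * path_sum \<alpha> k \<omega>)) \<partial>M"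
    have "(\<integral>\<^sup>+\<omega>. ennreal (exp (- (s * received \<alpha> k \<omega>))) \<partial>M) = ?E"
      using nn_integral_laplace_received[of s \<alpha> k] s0 k by (simp add: received_def)
    also have "?E \<le> ennreal (exp (- (active_intensity * \<gamma> k)))"
    proof -
      \<comment> \<open>The expectation is \<open>1 - active_intensity * \<gamma> k\<close> once
        read in the reals, and \<open>1 + x \<le> exp x\<close> then gives the exponential.\<close>
      have sum1: "?E + ennreal (active_intensity * \<gamma> k) = 1"
        using nn_integral_inverse_path_sum[OF s0 k, of \<alpha>] active_intensity_nonneg by (simp add: \<gamma> ennreal_mult)
      then have "?E \<noteq> \<top>" by auto
      then obtain e where e: "?E = ennreal e" "e \<ge> 0" by (cases ?E) auto
      then have "ennreal (e + active_intensity * \<gamma> k) = ennreal 1"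
        using sum1 active_intensity_nonneg \<gamma> by (simp add: ennreal_plus)
      then have "e + active_intensity * \<gamma> k = 1"
        using e active_intensity_nonneg \<gamma> by (subst (asm) ennreal_inj) auto
      then show ?thesis
        using exp_ge_add_one_self[of "- (active_intensity * \<gamma> k)"] e by (auto intro: ennreal_leI)
    qed
    finally show "(\<integral>\<^sup>+\<omega>. ennreal (exp (- (s * received \<alpha> k \<omega>))) \<partial>M) \<le> ennreal (exp (- (active_intensity * \<gamma> k)))" .
  qed
  also have "(\<Prod>k\<in>K. ennreal (exp (- (active_intensity * \<gamma> k)))) = ennreal (exp (- (active_intensity * (\<Sum>k\<in>K. \<gamma> k))))"
    using K by (simp add: prod_ennreal exp_sum[symmetric] sum_negf sum_distrib_left)
  also have "ennreal (exp (- (s / \<rho>))) * ennreal (exp (- (active_intensity * (\<Sum>k\<in>K. \<gamma> k)))) =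
      ennreal (exp (- (s / \<rho>)) * exp (- (active_intensity * (\<Sum>k\<in>K. \<gamma> k))))"
    by (simp add: ennreal_mult')
  finally show ?thesis
    by (simp add: emeasure_eq_measure mult_left_mono)
qed

text \<open>The finite bounds pass to the limit on the logarithmic scale: the sums of
  \<open>\<gamma> k\<close> over the grids, times the intensity, stay below one real
  \<open>y\<close>, hence so does their supremum, which monotone convergence identifies with the
  intensity times the integral outside the guard square.\<close>

lemma coverage_bound:
  assumes pos: "r_tr > 0" "\<rho> > 0" "\<beta> > 0" and s: "s = \<beta> * r_tr powr \<alpha>"
    and V: "ennreal V \<le> (\<integral>\<^sup>+x. ennreal (s / (s + ((norm x)\<^sup>2) powr (\<alpha> / 2))) * indicator (- square r_gz (0, 0)) x \<partial>lborel)"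
  shows "prob {\<omega> \<in> space M. ennreal \<beta> < sinr \<alpha> \<rho> r_tr r_gz \<Psi> h \<omega>} \<le> exp (- (s / \<rho>)) * exp (- (active_intensity * V))"
proof -
  let ?g = "\<lambda>x :: plane. ennreal (s / (s + ((norm x)\<^sup>2) powr (\<alpha> / 2)))"
  let ?P = "prob {\<omega> \<in> space M. ennreal \<beta> < sinr \<alpha> \<rho> r_tr r_gz \<Psi> h \<omega>}"
  have s0: "s > 0" using pos s by simp
  define \<gamma> where "\<gamma> k = enn2real (\<integral>\<^sup>+x. ?g x * indicator (square r_gz k) x \<partial>lborel)" for k
  have \<gamma>0: "\<gamma> k \<ge> 0" for k by (simp add: \<gamma>_def)
  \<comment> \<open>The integrand is at most 1 and a square has finite area, so
    \<open>enn2real\<close> loses nothing.\<close>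
  have \<gamma>: "(\<integral>\<^sup>+x. ?g x * indicator (square r_gz k) x \<partial>lborel) = ennreal (\<gamma> k)" for k
  proof -
    have "(\<integral>\<^sup>+x. ?g x * indicator (square r_gz k) x \<partial>lborel) \<le> (\<integral>\<^sup>+x. indicator (square r_gz k) x \<partial>lborel)"
      using s0 by (intro nn_integral_mono) (auto simp: indicator_def divide_le_eq_1 add_pos_nonneg)
    also have "\<dots> < \<top>" by (simp add: emeasure_square[OF r_pos])
    finally show ?thesis unfolding \<gamma>_def by simp
  qed
  have bound: "?P \<le> exp (- (s / \<rho>)) * exp (- (active_intensity * (\<Sum>k\<in>grid n - {(0, 0)}. \<gamma> k)))" for n
    using finite_grid by (intro coverage_le[OF _ _ pos s \<gamma>0 \<gamma>]) auto
  show ?thesis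
  proof (cases "?P = 0")
    case True
    then show ?thesis by simp
  next
    case False
    then have P: "?P > 0" by (simp add: zero_less_measure_iff)
    \<comment> \<open>The value \<open>v\<close> at which
      \<open>?P = exp (- (s / \<rho>)) * exp (- v)\<close>; the logarithm requires
      \<open>?P > 0\<close>.\<close>
    define y where "y = - ln ?P - s / \<rho>"
    have le: "active_intensity * (\<Sum>k\<in>grid n - {(0, 0)}. \<gamma> k) \<le> y" for n
    proof -
      have "ln ?P \<le> ln (exp (- (s / \<rho>)) * exp (- (active_intensity * (\<Sum>k\<in>grid n - {(0, 0)}. \<gamma> k))))"
        using bound[of n] P by (subst ln_le_cancel_iff) auto
      also have "\<dots> = - (s / \<rho>) - active_intensity * (\<Sum>k\<in>grid n - {(0, 0)}. \<gamma> k)"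
        by (simp add: mult_exp_exp)
      finally show ?thesis by (simp add: y_def)
    qed
    \<comment> \<open>An inequality in \<open>ennreal\<close> transfers back to the reals when its
      upper bound is nonnegative; no sign of \<open>V\<close> is assumed.\<close>
    have y0: "y \<ge> 0"
      using le[of 0] active_intensity_nonneg \<gamma>0 by (meson mult_nonneg_nonneg order_trans sum_nonneg)
    have sum_eq: "(\<integral>\<^sup>+x. ?g x * indicator (\<Union>k\<in>grid n - {(0, 0)}. square r_gz k) x \<partial>lborel) =
        ennreal (\<Sum>k\<in>grid n - {(0, 0)}. \<gamma> k)" for n
    proof -
      have "?g x * indicator (\<Union>k\<in>grid n - {(0, 0)}. square r_gz k) x =
          (\<Sum>k\<in>grid n - {(0, 0)}. ?g x * indicator (square r_gz k) x)" for x
      proof -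
        have "indicator (\<Union>k\<in>grid n - {(0, 0)}. square r_gz k) x =
            (\<Sum>k\<in>grid n - {(0, 0)}. indicator (square r_gz k) x :: ennreal)"
          using finite_grid disjoint_squares[OF r_pos]
          by (intro indicator_UN_disjoint) (auto simp: disjoint_family_on_def)
        then show ?thesis by (simp add: sum_distrib_left)
      qed
      then have "(\<integral>\<^sup>+x. ?g x * indicator (\<Union>k\<in>grid n - {(0, 0)}. square r_gz k) x \<partial>lborel) =
          (\<integral>\<^sup>+x. (\<Sum>k\<in>grid n - {(0, 0)}. ?g x * indicator (square r_gz k) x) \<partial>lborel)"
        by (intro nn_integral_cong)
      also have "\<dots> = (\<Sum>k\<in>grid n - {(0, 0)}. ennreal (\<gamma> k))"
        by (subst nn_integral_sum) (auto simp: \<gamma>)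
      also have "\<dots> = ennreal (\<Sum>k\<in>grid n - {(0, 0)}. \<gamma> k)"
        using \<gamma>0 by (intro sum_ennreal)
      finally show ?thesis .
    qed
    have cover: "(SUP n. indicator (\<Union>k\<in>grid n - {(0, 0)}. square r_gz k) x) =
        (indicator (- square r_gz (0, 0)) x :: ennreal)" for x
    proof (cases "x \<in> square r_gz (0, 0)")
      case True
      then have "x \<notin> (\<Union>k\<in>grid n - {(0, 0)}. square r_gz k)" for n
        using disjoint_squares[OF r_pos] by blast
      then have "indicator (\<Union>k\<in>grid n - {(0, 0)}. square r_gz k) x = (0 :: ennreal)" for n
        by (rule indicator_simps(2))
      then show ?thesis using True by (simp only: SUP_const UNIV_not_empty simp_thms) simp
    next
      case False
      let ?n = "nat (max \<bar>fst (square_of r_gz x)\<bar> \<bar>snd (square_of r_gz x)\<bar>)"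
      have x: "x \<in> square r_gz (square_of r_gz x)" using in_square_iff[OF r_pos] by blast
      then have "square_of r_gz x \<in> grid ?n - {(0, 0)}"
        using False mem_grid[of "square_of r_gz x"] by (metis Diff_iff singletonD)
      then have "x \<in> (\<Union>k\<in>grid ?n - {(0, 0)}. square r_gz k)" using x by blast
      then have "1 \<le> (indicator (\<Union>k\<in>grid ?n - {(0, 0)}. square r_gz k) x :: ennreal)"
        by (simp only: indicator_simps order_refl)
      then have "1 \<le> (SUP n. indicator (\<Union>k\<in>grid n - {(0, 0)}. square r_gz k) x :: ennreal)"
        by (rule SUP_upper2[OF UNIV_I])
      moreover have "(SUP n. indicator (\<Union>k\<in>grid n - {(0, 0)}. square r_gz k) x :: ennreal) \<le> 1"
        by (rule SUP_least) (simp add: indicator_def)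
      ultimately show ?thesis using False by (simp add: antisym)
    qed
    have "ennreal V \<le> (\<integral>\<^sup>+x. (SUP n. ?g x * indicator (\<Union>k\<in>grid n - {(0, 0)}. square r_gz k) x) \<partial>lborel)"
      using V by (simp add: SUP_mult_left_ennreal[symmetric] cover)
    also have "\<dots> = (SUP n. \<integral>\<^sup>+x. ?g x * indicator (\<Union>k\<in>grid n - {(0, 0)}. square r_gz k) x \<partial>lborel)"
    proof (rule nn_integral_monotone_convergence_SUP)
      show "incseq (\<lambda>n x. ?g x * indicator (\<Union>k\<in>grid n - {(0, 0)}. square r_gz k) x)"
      proof (intro monoI le_funI mult_left_mono)
        fix m n :: nat and x :: plane assume "m \<le> n"
        then have "(\<Union>k\<in>grid m - {(0, 0)}. square r_gz k) \<subseteq> (\<Union>k\<in>grid n - {(0, 0)}. square r_gz k)"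
          using mono_grid by blast
        then have "x \<in> (\<Union>k\<in>grid m - {(0, 0)}. square r_gz k) \<Longrightarrow> x \<in> (\<Union>k\<in>grid n - {(0, 0)}. square r_gz k)"
          by (rule subsetD)
        then show "indicator (\<Union>k\<in>grid m - {(0, 0)}. square r_gz k) x \<le>
            (indicator (\<Union>k\<in>grid n - {(0, 0)}. square r_gz k) x :: ennreal)"
          by (rule indicator_leI)
      qed simp
      fix n :: nat
      have [measurable]: "(\<Union>k\<in>grid n - {(0, 0)}. square r_gz k) \<in> sets borel"
        using finite_grid by (intro sets.finite_UN) auto
      show "(\<lambda>x. ?g x * indicator (\<Union>k\<in>grid n - {(0, 0)}. square r_gz k) x) \<in> borel_measurable lborel"
        by measurable
    qed
    also have "\<dots> = (SUP n. ennreal (\<Sum>k\<in>grid n - {(0, 0)}. \<gamma> k))"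
      by (simp only: sum_eq)
    finally have "ennreal active_intensity * ennreal V \<le> ennreal active_intensity * (SUP n. ennreal (\<Sum>k\<in>grid n - {(0, 0)}. \<gamma> k))"
      by (rule mult_left_mono) simp
    also have "\<dots> = (SUP n. ennreal (active_intensity * (\<Sum>k\<in>grid n - {(0, 0)}. \<gamma> k)))"
      using active_intensity_nonneg by (simp add: SUP_mult_left_ennreal ennreal_mult')
    also have "\<dots> \<le> ennreal y"
      by (intro SUP_least ennreal_leI le)
    finally have "ennreal (active_intensity * V) \<le> ennreal y"
      using active_intensity_nonneg by (simp add: ennreal_mult')
    then have "active_intensity * V \<le> y"
      using y0 by (simp add: ennreal_le_iff)
    then have "ln ?P \<le> - (s / \<rho>) - active_intensity * V" by (simp add: y_def)
    then have "exp (ln ?P) \<le> exp (- (s / \<rho>) - active_intensity * V)"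
      by (simp only: exp_le_cancel_iff)
    then have "?P \<le> exp (- (s / \<rho>) - active_intensity * V)"
      using P by (simp only: exp_ln)
    then show ?thesis by (simp add: mult_exp_exp)
  qed
qed

end

theorem theorem3:
  fixes M :: "'w measure"
    and \<alpha> lam r_gz r_tr \<rho> \<beta> lam_CA :: real
    and \<Phi> \<Psi> :: "'w \<Rightarrow> plane set"
    and h :: "int \<times> int \<Rightarrow> 'w \<Rightarrow> real"
  assumes "CA_network M lam r_gz \<Phi> \<Psi> h"
    and "\<alpha> > 2"
    and "lam > 0" "r_gz > 0" "r_tr > 0" "\<rho> > 0" "\<beta> > 0"
    and "lam_CA = (1 - exp (- 4 * lam * r_gz\<^sup>2)) / (4 * r_gz\<^sup>2)"
  shows "has_intensity M \<Psi> lam_CA \<and>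
    throughput M \<alpha> \<rho> r_tr r_gz \<Psi> h \<beta> \<le>
      exp (- (\<beta> * r_tr powr \<alpha> / \<rho>)) * lam_CA *
      exp (- pi * lam_CA *
        (2 * (\<beta> * r_tr powr \<alpha>) powr (2 / \<alpha>) * Gamma (2 / \<alpha>) * Gamma (1 - 2 / \<alpha>) / \<alpha>
         - (2 * r_gz / sqrt pi)\<^sup>2 *
           hyp2F1_real (2 / \<alpha>) 1 (1 + 2 / \<alpha>)
             (- ((2 * r_gz / (sqrt pi * r_tr)) powr \<alpha> * (1 / \<beta>)))))"
proof -
  interpret positive_CA_network M lam r_gz \<Phi> \<Psi> h
    using assms by (auto intro!: positive_CA_network.intro positive_CA_network_axioms.intro)
  define s where "s = \<beta> * r_tr powr \<alpha>"
  define R where "R = 2 * r_gz / sqrt pi"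
  \<comment> \<open>With the squared norm as variable the path loss exponent is halved, and
    \<open>\<alpha> > 2\<close> becomes \<open>p > 1\<close>.\<close>
  define p where "p = \<alpha> / 2"
  define V where "V = pi * (s powr (1 / p) * Beta (1 - 1 / p) (1 + 1 / p)) -
      pi * R\<^sup>2 * hyp2F1_real (1 / p) 1 (1 + 1 / p) (- ((R\<^sup>2) powr p / s))"
  have s: "s > 0" and R: "R > 0" and p: "p > 1" using assms by (simp_all add: s_def R_def p_def)
  have lam_CA: "active_intensity = lam_CA"
    using assms(8) by (simp add: active_intensity_def mult.assoc mult.left_commute)
  have area: "pi * R\<^sup>2 = 4 * r_gz\<^sup>2"
    by (simp add: R_def power_divide power_mult_distrib)
  have "ennreal V \<le> (\<integral>\<^sup>+x. ennreal (s / (s + ((norm x)\<^sup>2) powr (\<alpha> / 2))) * indicator (- square r_gz (0, 0)) x \<partial>lborel)"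
    unfolding V_def p_def[symmetric]
    by (rule nn_integral_outside_ge[OF s p R]) (simp_all add: area emeasure_square[OF r_pos])
  then have coverage: "prob {\<omega> \<in> space M. ennreal \<beta> < sinr \<alpha> \<rho> r_tr r_gz \<Psi> h \<omega>} \<le>
      exp (- (s / \<rho>)) * exp (- (lam_CA * V))"
    using coverage_bound[of r_tr \<rho> \<beta> s \<alpha> V] assms s_def by (simp only: lam_CA)
  have "{\<omega> \<in> space M. ennreal \<beta> < sinr \<alpha> \<rho> r_tr r_gz \<Psi> h \<omega>} =
      space M - {\<omega> \<in> space M. sinr \<alpha> \<rho> r_tr r_gz \<Psi> h \<omega> \<le> ennreal \<beta>}"
    by auto
  then have "prob {\<omega> \<in> space M. ennreal \<beta> < sinr \<alpha> \<rho> r_tr r_gz \<Psi> h \<omega>} = 1 - outage M \<alpha> \<rho> r_tr r_gz \<Psi> h \<beta>"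
    by (simp add: outage_def prob_compl)
  then have "throughput M \<alpha> \<rho> r_tr r_gz \<Psi> h \<beta> =
      lam_CA * prob {\<omega> \<in> space M. ennreal \<beta> < sinr \<alpha> \<rho> r_tr r_gz \<Psi> h \<omega>}"
    by (simp add: throughput_def intensity_eqI[OF has_intensity_Psi] lam_CA)
  also have "\<dots> \<le> lam_CA * (exp (- (s / \<rho>)) * exp (- (lam_CA * V)))"
    using coverage active_intensity_nonneg by (intro mult_left_mono) (simp_all add: lam_CA)
  finally have throughput: "throughput M \<alpha> \<rho> r_tr r_gz \<Psi> h \<beta> \<le> exp (- (s / \<rho>)) * lam_CA * exp (- (lam_CA * V))"
    by (simp only: mult_ac)
  \<comment> \<open>This recursion is the origin of the factor \<open>2 / \<alpha>\<close> in the
    Gamma term; the denominator of the Beta function is \<open>Gamma 2 = 1\<close>.\<close>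
  have "Gamma (1 + 2 / \<alpha>) = 2 / \<alpha> * Gamma (2 / \<alpha>)"
  proof -
    have "0 < 2 / \<alpha>" using assms by simp
    then have "2 / \<alpha> \<notin> \<int>\<^sub>\<le>\<^sub>0" by (metis nonpos_Ints_cases of_int_le_0_iff not_less)
    from Gamma_plus1[OF this] show ?thesis by (simp only: add.commute)
  qed
  then have Beta_eq: "Beta (1 - 2 / \<alpha>) (1 + 2 / \<alpha>) = 2 * Gamma (2 / \<alpha>) * Gamma (1 - 2 / \<alpha>) / \<alpha>"
    by (simp add: Beta_def Gamma_numeral)
  have arg: "(R\<^sup>2) powr p / s = (2 * r_gz / (sqrt pi * r_tr)) powr \<alpha> * (1 / \<beta>)"
  proof -
    have "(R\<^sup>2) powr p = R powr \<alpha>"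
      using R by (simp add: p_def powr_powr flip: powr_numeral)
    moreover have "(2 * r_gz / (sqrt pi * r_tr)) powr \<alpha> = R powr \<alpha> / r_tr powr \<alpha>"
      using R assms by (simp add: R_def powr_divide[symmetric])
    ultimately show ?thesis by (simp add: s_def)
  qed
  have "- (lam_CA * V) = - pi * lam_CA *
        (2 * (\<beta> * r_tr powr \<alpha>) powr (2 / \<alpha>) * Gamma (2 / \<alpha>) * Gamma (1 - 2 / \<alpha>) / \<alpha>
         - (2 * r_gz / sqrt pi)\<^sup>2 *
           hyp2F1_real (2 / \<alpha>) 1 (1 + 2 / \<alpha>)
             (- ((2 * r_gz / (sqrt pi * r_tr)) powr \<alpha> * (1 / \<beta>))))"
    unfolding V_def arg R_def[symmetric] s_def[symmetric]
    by (simp add: p_def Beta_eq right_diff_distrib mult_ac)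
  then show ?thesis
    using throughput has_intensity_Psi by (simp only: lam_CA s_def simp_thms)
qed

end
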